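(* Let $\alpha,\beta$ be positive real numbers with $\alpha\beta=\pi^2$, let $k,N$ be positive integers, and let $a,b>0$. Then $$ \begin{aligned} \beta^{k(N+1)-1}\sum_{n=0}^{\infty}\frac{(-1)^nF_\alpha(n+b,a;k)}{(n+b)^{2k(N+1)-1}} &=(-1)^N\alpha^{k(N+1)-1}\sum_{n=0}^{\infty}\frac{(-1)^nF_\beta(n+a,b;k)}{(n+a)^{2k(N+1)-1}}\\ &\quad+\sum_{p=0}^{N+1}(-1)^{p+1}\zeta_E(2kp,a)\,\zeta_E(2k(N-p+1),b)\,\alpha^{kp-1}\beta^{k(N+1-p)-1}. \end{aligned} $$
   Context: The alternating Hurwitz zeta function is $\zeta_E(z,x)=\sum_{n=0}^{\infty}\frac{(-1)^n}{(n+x)^z}$ for $\operatorname{Re}(z)>0$, continued analytically in $z$ to all of $\mathbb{C}$ (in particular to $z=0$). For $x>0$ and a positive integer $k$, the even-order alternating Hurwitz kernel is $$F(x,a;k)=\frac{1}{2\pi i}\int_{(c)}\frac{\zeta_E(1-s,a)}{2k\cos\left(\frac{\pi(s+k-1)}{2k}\right)}x^{-s}\,ds=-\frac{1}{2\pi x}+\frac{x^{2k-1}}{\pi}\sum_{n=0}^{\infty}\frac{(-1)^n}{(n+a)^{2k}+x^{2k}},$$ where $(c)$ is the vertical line $\operatorname{Re}(s)=c$ with $1<c<2$. For $\alpha>0$, $F_\alpha(x,a;k)=F\!\left(\frac{\alpha x}{\pi},a;k\right)$, and similarly $F_\beta$. *)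

theory Defs
  imports "HOL-Complex_Analysis.Complex_Analysis"
begin

text \<open>
  The alternating Hurwitz zeta function, for a real parameter \<open>x > 0\<close>: the unique entire function
  given by the (for \<open>Re z \<le> 1\<close> only conditionally convergent) alternating series on \<open>Re z > 0\<close>.
\<close>

definition alt_hurwitz_zeta :: "complex \<Rightarrow> real \<Rightarrow> complex" where
  "alt_hurwitz_zeta z x =
     (THE f. f holomorphic_on UNIV \<and>
        (\<forall>w. Re w > 0 \<longrightarrow> (\<lambda>n. (-1) ^ n / of_real (real n + x) powr w) sums f w)) z"

text \<open>
  The even-order alternating Hurwitz kernel, defined by its Mellin--Barnes integral over the line
  \<open>Re s = c\<close>, parametrised as \<open>s = c + \<i> t\<close>, \<open>ds = \<i> dt\<close>. The value is meant to be used for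
  \<open>1 < c < 2\<close>, where it does not depend on \<open>c\<close>.
\<close>

definition alt_hurwitz_kernel :: "real \<Rightarrow> real \<Rightarrow> real \<Rightarrow> nat \<Rightarrow> complex" where
  "alt_hurwitz_kernel c x a k =
     1 / (2 * of_real pi * \<i>) *
     (LBINT t. (let s = Complex c t in
        alt_hurwitz_zeta (1 - s) a
          / (2 * of_nat k * cos (of_real pi * (s + of_nat k - 1) / (2 * of_nat k)))
          * of_real x powr (- s)) * \<i>)"

definition scaled_alt_hurwitz_kernel :: "real \<Rightarrow> real \<Rightarrow> real \<Rightarrow> real \<Rightarrow> nat \<Rightarrow> complex" where
  "scaled_alt_hurwitz_kernel c \<alpha> x a k = alt_hurwitz_kernel c (\<alpha> * x / pi) a k"

end

theory Submission
  imports Defs "HOL-Probability.Sinc_Integral"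
begin

text \<open>
  The Euler transform \<open>\<Sum>(-1)\<^sup>n g(n + x) = g(x)/2 + 1/2 \<Sum>(-1)\<^sup>n (g(n + x) - g(n + 1 + x))\<close> gains one power of
  decay per step when \<open>g(y) = y\<^sup>-\<^sup>z\<close>; iterated \<open>M\<close> times, it continues the alternating zeta function to
  \<open>Re z > 1 - M\<close> by an absolutely convergent series. For \<open>M = 2\<close> this covers the line \<open>Re s = c\<close> of the
  kernel, so the Mellin--Barnes integral can be computed term by term. Each term is elementary: up to
  constants it is the integral of \<open>exp (- l w) / sin (\<pi> w / L)\<close> along a vertical line, and this integrand
  is multiplied by a constant under \<open>w \<mapsto> w + L\<close>, so that the residue theorem on the strip between
  the two lines determines the integral. Undoing the Euler transform gives the closed form of the kernel.

  With \<open>P = (n + a)\<^sup>2\<^sup>k\<close> and \<open>Q = (m + b)\<^sup>2\<^sup>k\<close> both sides of the identity become absolutely convergent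
  double series with the common denominator \<open>\<beta>\<^sup>k P + \<alpha>\<^sup>k Q\<close>. This denominator divides
  \<open>(\<beta>\<^sup>k P)\<^sup>N - (- \<alpha>\<^sup>k Q)\<^sup>N\<close>, and the quotient, a geometric sum, yields the products of zeta values for
  \<open>1 \<le> p \<le> N\<close>. The terms \<open>p = 0\<close> and \<open>p = N + 1\<close> come from \<open>- 1 / (2 \<pi> x)\<close> in the kernel.
\<close>

subsection \<open>Analytic continuation of the alternating zeta function\<close>

text \<open>The sign is opposite to the usual forward difference. In an alternating series, adding
  the series to its shift by one index then gives \<open>fdiff\<close> with no further
  signs.\<close>

definition fdiff :: "(real \<Rightarrow> complex) \<Rightarrow> real \<Rightarrow> complex"
  where "fdiff g x = g x - g (x + 1)"

text \<open>The exponent comes first, so that \<open>fdiff\<close> acts on the base of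
  \<open>npow z\<close> while holomorphy is studied in \<open>z\<close>.\<close>

definition npow :: "complex \<Rightarrow> real \<Rightarrow> complex"
  where "npow z x = of_real x powr (- z)"

lemma npow_has_vector_derivative:
  assumes "x > 0"
  shows "(npow z has_vector_derivative - z * npow (z + 1) x) (at x)"
proof -
  have "((\<lambda>w. w powr (- z)) has_field_derivative - z * npow (z + 1) x) (at (of_real x))"
    using assms unfolding npow_def
    by (auto intro!: derivative_eq_intros simp: minus_diff_commute)
  from has_vector_derivative_real_field[OF this] show ?thesis
    unfolding npow_def by simp
qed

lemma fdiff_has_vector_derivative:
  assumes "\<And>x. x > 0 \<Longrightarrow> (g has_vector_derivative g' x) (at x)" and "x > 0"
  shows "(fdiff g has_vector_derivative fdiff g' x) (at x)"
proof -
  have "((\<lambda>x. g (x + 1)) has_vector_derivative g' (x + 1)) (at x)"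
    using vector_diff_chain_at[of "\<lambda>x. x + 1" 1 x g "g' (x + 1)"] assms(1)[of "x + 1"] assms(2)
    by (simp add: o_def add.commute has_vector_derivative_add_const has_vector_derivative_id)
  thus ?thesis using assms unfolding fdiff_def
    by (auto intro!: derivative_eq_intros)
qed

text \<open>Differences commute with differentiation, so the derivative only raises the exponent by
  one, whatever the number of differences already taken.\<close>

lemma funpow_fdiff_npow_has_vector_derivative:
  assumes "x > 0"
  shows "((fdiff ^^ M) (npow z) has_vector_derivative - z * (fdiff ^^ M) (npow (z + 1)) x) (at x)"
  using assms
proof (induction M arbitrary: x)
  case 0
  thus ?case using npow_has_vector_derivative[of x z] by simp
next
  case (Suc M)
  have "(fdiff ((fdiff ^^ M) (npow z)) has_vector_derivative
          fdiff (\<lambda>x. - z * (fdiff ^^ M) (npow (z + 1)) x) x) (at x)"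
    by (rule fdiff_has_vector_derivative) (use Suc in auto)
  moreover have "fdiff (\<lambda>x. - z * (fdiff ^^ M) (npow (z + 1)) x) x
      = - z * (fdiff ^^ Suc M) (npow (z + 1)) x"
    by (simp add: fdiff_def algebra_simps)
  ultimately show ?case by simp
qed

section \<open>Decay of iterated differences of powers\<close>

lemma norm_npow: "x > 0 \<Longrightarrow> norm (npow z x) = x powr (- Re z)"
  by (simp add: npow_def norm_powr_real_powr)

text \<open>The mean value inequality on \<open>{x..x+1}\<close> trades one difference for one
  derivative, that is, for a factor \<open>norm z\<close> and one more power of decay; induction
  does the rest. The condition on \<open>Re z\<close> makes the exponent of the bound nonpositive,
  so that over the interval the bound is largest at \<open>x\<close>.\<close>

lemma norm_funpow_fdiff_npow_le:
  assumes "x > 0" and "Re z + real M \<ge> 0"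
  shows "norm ((fdiff ^^ M) (npow z) x) \<le> (\<Prod>i<M. norm (z + of_nat i)) * x powr (- Re z - real M)"
  using assms
proof (induction M arbitrary: x z)
  case 0
  thus ?case by (simp add: norm_npow)
next
  case (Suc M)
  let ?g = "(fdiff ^^ M) (npow z)"
  let ?B = "(\<Prod>i<Suc M. norm (z + of_nat i)) * x powr (- Re z - real (Suc M))"
  have "norm (?g x - ?g (x + 1)) \<le> ?B * norm (x - (x + 1))"
  proof (rule differentiable_bound)
    show "convex {x..x+1}" by simp
    fix y assume y: "y \<in> {x..x+1}"
    hence "y > 0" using Suc.prems by auto
    from funpow_fdiff_npow_has_vector_derivative[OF this, of M z]
    show "(?g has_derivative (\<lambda>h. h *\<^sub>R (- z * (fdiff ^^ M) (npow (z + 1)) y))) (at y within {x..x+1})"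
      unfolding has_vector_derivative_def by (rule has_derivative_at_withinI)
    have "onorm (\<lambda>h. h *\<^sub>R (- z * (fdiff ^^ M) (npow (z + 1)) y)) \<le> norm (- z * (fdiff ^^ M) (npow (z + 1)) y)"
      by (rule onorm_le) (simp add: mult.commute)
    also have "\<dots> = norm z * norm ((fdiff ^^ M) (npow (z + 1)) y)"
      by (simp add: norm_mult)
    also have "\<dots> \<le> norm z * ((\<Prod>i<M. norm (z + 1 + of_nat i)) * y powr (- Re (z + 1) - real M))"
      using Suc.prems \<open>y > 0\<close> by (intro mult_left_mono Suc.IH) auto
    also have "\<dots> \<le> norm z * ((\<Prod>i<M. norm (z + 1 + of_nat i)) * x powr (- Re (z + 1) - real M))"
      using Suc.prems y by (intro mult_left_mono powr_mono2' prod_nonneg) auto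
    also have "\<dots> = ?B"
      \<comment> \<open>The factor \<open>norm z\<close> is the one for \<open>i = 0\<close>; the
        factors for \<open>z + 1\<close> are the later ones, shifted.\<close>
      unfolding prod.lessThan_Suc_shift by (simp add: add.assoc diff_diff_eq)
    finally show "onorm (\<lambda>h. h *\<^sub>R (- z * (fdiff ^^ M) (npow (z + 1)) y)) \<le> ?B" .
  qed auto
  thus ?case by (simp add: fdiff_def[of ?g])
qed

text \<open>Shifting the index by one flips the sign and loses the first term. Only convergence of
  the series is used, so this also applies to conditionally convergent ones.\<close>

lemma sums_fdiff:
  assumes "(\<lambda>n. (-1) ^ n * g (real n + x)) sums S"
  shows "(\<lambda>n. (-1) ^ n * fdiff g (real n + x)) sums (2 * S - g x)"
proof -
  have "(\<lambda>n. (-1) ^ Suc n * g (real (Suc n) + x)) sums (S - g x)"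
    using assms by (subst sums_Suc_iff) simp
  from sums_add[OF assms this] show ?thesis
    by (simp add: fdiff_def algebra_simps)
qed

text \<open>Up to the factor 2 and the term \<open>g x\<close>, the partial sums of both series
  differ by a boundary term \<open>(-1) ^ m * g (real m + x)\<close>. This is why \<open>g\<close>
  must tend to 0 here. The lemma recovers a conditionally convergent series from the absolutely
  convergent series of its differences.\<close>

lemma sums_of_fdiff:
  assumes "(\<lambda>n. (-1) ^ n * fdiff g (real n + x)) sums T" and "(\<lambda>n. g (real n + x)) \<longlonglongrightarrow> 0"
  shows "(\<lambda>n. (-1) ^ n * g (real n + x)) sums ((T + g x) / 2)"
proof -
  have eq: "2 * (\<Sum>n<m. (-1) ^ n * g (real n + x))
        = (\<Sum>n<m. (-1) ^ n * fdiff g (real n + x)) + g x - (-1) ^ m * g (real m + x)" for m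
    by (induction m) (simp_all add: fdiff_def algebra_simps)
  have "(\<lambda>m. (-1) ^ m * g (real m + x)) \<longlonglongrightarrow> 0"
    using assms(2) by (subst tendsto_norm_zero_iff[symmetric]) (simp add: norm_mult norm_power tendsto_norm_zero)
  hence "(\<lambda>m. ((\<Sum>n<m. (-1) ^ n * fdiff g (real n + x)) + g x - (-1) ^ m * g (real m + x)) / 2)
      \<longlonglongrightarrow> (T + g x - 0) / 2"
    using assms(1) unfolding sums_def by (intro tendsto_intros) auto
  moreover have "((\<Sum>n<m. (-1) ^ n * fdiff g (real n + x)) + g x - (-1) ^ m * g (real m + x)) / 2
      = (\<Sum>n<m. (-1) ^ n * g (real n + x))" for m
    by (subst eq[symmetric]) simp
  ultimately show ?thesis by (simp only: sums_def) simp
qed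

lemma summable_shifted_powr:
  assumes "s < -1" "x > 0"
  shows "summable (\<lambda>n. (real n + x) powr s)"
proof (rule summable_comparison_test')
  show "summable (\<lambda>n. real n powr s)" using assms by (simp add: summable_real_powr_iff)
  show "norm ((real n + x) powr s) \<le> real n powr s" if "n \<ge> 1" for n
    using that assms by (simp add: powr_mono2')
qed

text \<open>The series for \<open>\<Sum>(-1)\<^sup>n (n + x)\<^sup>-\<^sup>z\<close> after \<open>M\<close> steps of the Euler transform.\<close>

definition euler_sum :: "nat \<Rightarrow> real \<Rightarrow> complex \<Rightarrow> complex"
  where "euler_sum M x z = (\<Sum>j<M. (fdiff ^^ j) (npow z) x / 2 ^ Suc j)
     + (\<Sum>n. (-1) ^ n * (fdiff ^^ M) (npow z) (real n + x)) / 2 ^ M"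

lemma summable_norm_fdiff_npow:
  assumes "x > 0" and "Re z > 1 - real M"
  shows "summable (\<lambda>n. norm ((-1) ^ n * (fdiff ^^ M) (npow z) (real n + x)))"
proof (rule summable_comparison_test')
  show "summable (\<lambda>n. (\<Prod>i<M. norm (z + of_nat i)) * (real n + x) powr (- Re z - real M))"
    using assms by (intro summable_mult summable_shifted_powr) auto
  show "norm (norm ((-1) ^ n * (fdiff ^^ M) (npow z) (real n + x)))
         \<le> (\<Prod>i<M. norm (z + of_nat i)) * (real n + x) powr (- Re z - real M)" for n
    using norm_funpow_fdiff_npow_le[where z = z and M = M and x = "real n + x"] assms by (simp add: norm_mult norm_power)
qed

text \<open>By \<open>sums_fdiff\<close>, halving the series of the next differences reproduces the
  old series minus half its first term, and this half is exactly the new summand for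
  \<open>j = M\<close>.\<close>

lemma euler_sum_Suc:
  assumes "x > 0" and "Re z > 1 - real M"
  shows "euler_sum (Suc M) x z = euler_sum M x z"
proof -
  have "(\<lambda>n. (-1) ^ n * (fdiff ^^ M) (npow z) (real n + x)) sums
       (\<Sum>n. (-1) ^ n * (fdiff ^^ M) (npow z) (real n + x))"
    using summable_norm_fdiff_npow[OF assms] by (rule summable_sums[OF summable_norm_cancel])
  hence "(\<lambda>n. (-1) ^ n * fdiff ((fdiff ^^ M) (npow z)) (real n + x)) sums
      (2 * (\<Sum>n. (-1) ^ n * (fdiff ^^ M) (npow z) (real n + x)) - (fdiff ^^ M) (npow z) x)"
    by (rule sums_fdiff)
  from sums_unique[OF this, symmetric] show ?thesis
    by (simp add: euler_sum_def diff_divide_distrib)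
qed

lemma euler_sum_eq:
  assumes "x > 0" and "Re z > 1 - real M" and "M \<le> M'"
  shows "euler_sum M' x z = euler_sum M x z"
  using assms(3)
proof (induction M' rule: dec_induct)
  case (step m)
  thus ?case using euler_sum_Suc[of x m z] assms by auto
qed simp

text \<open>For \<open>Re z > 0\<close> one difference already makes the series absolutely
  convergent, and the terms themselves tend to 0, so \<open>sums_of_fdiff\<close> carries
  convergence back.\<close>

lemma euler_sum_sums:
  assumes "x > 0" and "Re z > 0"
  shows "(\<lambda>n. (-1) ^ n / of_real (real n + x) powr z) sums euler_sum 1 x z"
proof -
  have "(\<lambda>n. (-1) ^ n * fdiff (npow z) (real n + x)) sums
       (\<Sum>n. (-1) ^ n * fdiff (npow z) (real n + x))"
    using summable_norm_fdiff_npow[of x 1 z] assms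
    by (intro summable_sums[OF summable_norm_cancel]) simp
  moreover have "(\<lambda>n. npow z (real n + x)) \<longlonglongrightarrow> 0"
  proof (rule tendsto_norm_zero_cancel)
    have "((\<lambda>n. (real n + x) powr (- Re z)) \<longlongrightarrow> 0) sequentially"
      using assms by real_asymp
    moreover have "norm (npow z (real n + x)) = (real n + x) powr (- Re z)" for n
      using assms by (simp add: norm_npow)
    ultimately show "(\<lambda>n. norm (npow z (real n + x))) \<longlonglongrightarrow> 0" by simp
  qed
  ultimately have "(\<lambda>n. (-1) ^ n * npow z (real n + x)) sums
      (((\<Sum>n. (-1) ^ n * fdiff (npow z) (real n + x)) + npow z x) / 2)"
    by (rule sums_of_fdiff)
  hence "(\<lambda>n. (-1) ^ n * npow z (real n + x)) sums euler_sum 1 x z"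
    by (simp add: euler_sum_def add_divide_distrib add.commute)
  moreover have "(-1) ^ n * npow z (real n + x) = (-1) ^ n / of_real (real n + x) powr z" for n
    by (simp add: npow_def powr_minus field_simps)
  ultimately show ?thesis by simp
qed

section \<open>Holomorphy, gluing and uniqueness of the continuation\<close>

lemma npow_holomorphic: "(\<lambda>z. npow z x) holomorphic_on S"
  unfolding npow_def by (intro holomorphic_intros)

lemma funpow_fdiff_npow_holomorphic: "(\<lambda>z. (fdiff ^^ M) (npow z) x) holomorphic_on S"
  by (induction M arbitrary: x) (auto simp: fdiff_def npow_holomorphic intro!: holomorphic_intros)

lemma euler_sum_holomorphic:
  assumes "x > 0"
  shows "euler_sum M x holomorphic_on {z. Re z > 1 - real M}"
proof -
  let ?S = "{z. Re z > 1 - real M}"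
  let ?h = "\<lambda>n z. (-1) ^ n * (fdiff ^^ M) (npow z) (real n + x)"
  have op: "open ?S" by (simp add: open_halfspace_Re_gt)
  have "(\<lambda>z. \<Sum>n. ?h n z) holomorphic_on ?S"
  proof (rule holomorphic_uniform_sequence[OF op])
    show "(\<lambda>z. \<Sum>n<m. ?h n z) holomorphic_on ?S" for m
      by (intro holomorphic_intros funpow_fdiff_npow_holomorphic)
    fix w assume w: "w \<in> ?S"
    \<comment> \<open>Half the distance from \<open>w\<close> to the boundary line. On
      \<open>cball w d\<close> the exponent of the term bound is then at most
      \<open>- 1 - d\<close>, uniformly in \<open>z\<close>.\<close>
    define d where "d = (Re w - (1 - real M)) / 2"
    have d: "d > 0" using w by (simp add: d_def)
    have Re: "Re z \<ge> 1 - real M + d" if "z \<in> cball w d" for z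
      using abs_Re_le_cmod[of "w - z"] that by (simp add: dist_norm d_def field_simps)
    define P where "P = (\<Prod>i<M. norm w + d + real i)"
    have "uniform_limit (cball w d) (\<lambda>m z. \<Sum>n<m. ?h n z) (\<lambda>z. \<Sum>n. ?h n z) sequentially"
    proof (rule Weierstrass_m_test_ev)
      show "summable (\<lambda>n. P * (real n + x) powr (- 1 - d))"
        using d assms by (intro summable_mult summable_shifted_powr) auto
      \<comment> \<open>From \<open>n = 1\<close> on the base \<open>real n + x\<close> is at least
        1, so that \<open>powr\<close> is monotone in the exponent.\<close>
      have "norm (?h n z) \<le> P * (real n + x) powr (- 1 - d)" if "n \<ge> 1" "z \<in> cball w d" for n z
      proof -
        have "norm (?h n z) \<le> (\<Prod>i<M. norm (z + of_nat i)) * (real n + x) powr (- Re z - real M)"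
          using norm_funpow_fdiff_npow_le[where z = z and M = M and x = "real n + x"] assms Re[OF that(2)] d
          by (simp add: norm_mult norm_power)
        also have "\<dots> \<le> P * (real n + x) powr (- 1 - d)"
        proof (intro mult_mono)
          have "norm z \<le> norm w + d"
            using that(2) norm_triangle_ineq2[of z w] by (simp add: dist_norm norm_minus_commute)
          thus "(\<Prod>i<M. norm (z + of_nat i)) \<le> P"
            unfolding P_def by (intro prod_mono) (auto intro: order_trans[OF norm_triangle_ineq])
          show "(real n + x) powr (- Re z - real M) \<le> (real n + x) powr (- 1 - d)"
            using Re[OF that(2)] assms that(1) by (intro powr_mono) auto
          show "P \<ge> 0" unfolding P_def using d by (intro prod_nonneg) auto
        qed auto
        finally show ?thesis .
      qed
      thus "\<forall>\<^sub>F n in sequentially. \<forall>z\<in>cball w d. norm (?h n z) \<le> P * (real n + x) powr (- 1 - d)"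
        unfolding eventually_sequentially by blast
    qed
    moreover have "cball w d \<subseteq> ?S" using Re d by force
    ultimately show "\<exists>d>0. cball w d \<subseteq> ?S \<and>
        uniform_limit (cball w d) (\<lambda>m z. \<Sum>n<m. ?h n z) (\<lambda>z. \<Sum>n. ?h n z) sequentially"
      using d by blast
  qed
  thus ?thesis unfolding euler_sum_def
    by (intro holomorphic_intros funpow_fdiff_npow_holomorphic) auto
qed

text \<open>Two candidates agree on the right half-plane because sums of series are unique, hence
  everywhere by the identity theorem. This discharges the definite description.\<close>

lemma alt_hurwitz_zeta_unique:
  assumes "x > 0" "f holomorphic_on UNIV"
    "\<And>w. Re w > 0 \<Longrightarrow> (\<lambda>n. (-1) ^ n / of_real (real n + x) powr w) sums f w"
  shows "alt_hurwitz_zeta z x = f z"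
proof -
  have "(THE f. f holomorphic_on UNIV \<and>
        (\<forall>w. Re w > 0 \<longrightarrow> (\<lambda>n. (-1) ^ n / of_real (real n + x) powr w) sums f w)) = f"
  proof (rule the_equality)
    fix g assume g: "g holomorphic_on UNIV \<and>
        (\<forall>w. Re w > 0 \<longrightarrow> (\<lambda>n. (-1) ^ n / of_real (real n + x) powr w) sums g w)"
    have eq: "g w = f w" if "Re w > 0" for w
      using g assms(3)[OF that] that sums_unique2 by blast
    show "g = f"
    proof
      fix w
      show "g w = f w"
      proof (rule analytic_continuation_open[where f = g and g = f and s = "{w. Re w > 0}" and s' = UNIV])
        show "{w. Re w > 0} \<noteq> {}" by (auto intro!: exI[of _ 1])
      qed (use g assms eq in \<open>auto simp: open_halfspace_Re_gt\<close>)
    qed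
  qed (use assms in auto)
  thus ?thesis by (simp add: alt_hurwitz_zeta_def)
qed

theorem alt_hurwitz_zeta_eq_euler_sum:
  assumes "x > 0" and "Re z > 1 - real M"
  shows "alt_hurwitz_zeta z x = euler_sum M x z"
proof -
  \<comment> \<open>Gluing over the half-planes: the number of steps is chosen large enough for each
    \<open>w\<close>, and by \<open>euler_sum_eq\<close> any other admissible number gives the same
    value.\<close>
  define E where "E w = euler_sum (nat \<lceil>2 - Re w\<rceil>) x w" for w
  have E: "E w = euler_sum m x w" if "Re w > 1 - real m" for w m
  proof -
    have "Re w > 1 - real (nat \<lceil>2 - Re w\<rceil>)" by linarith
    thus ?thesis unfolding E_def using euler_sum_eq[OF assms(1)] that
      by (metis nle_le)
  qed
  have "E holomorphic_on UNIV"
  proof -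
    have "E analytic_on UNIV" unfolding analytic_on_open[OF open_UNIV]
    proof (rule holomorphic_on_subset)
      have "E holomorphic_on (\<Union>m. {z. Re z > 1 - real m})"
      proof (rule holomorphic_on_UN_open)
        fix m
        show "E holomorphic_on {z. Re z > 1 - real m}"
          using holomorphic_transform[OF euler_sum_holomorphic[OF assms(1), of m]] E by auto
      qed (simp add: open_halfspace_Re_gt)
      thus "E holomorphic_on (\<Union>m. {z. Re z > 1 - real m})" .
      show "UNIV \<subseteq> (\<Union>m. {z. Re z > 1 - real m})"
      proof
        fix w :: complex
        obtain m :: nat where "real m > 1 - Re w" using reals_Archimedean2 by blast
        thus "w \<in> (\<Union>m. {z. Re z > 1 - real m})" by (auto intro!: exI[of _ m])
      qed
    qed
    thus ?thesis by (simp add: analytic_on_open)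
  qed
  moreover have "(\<lambda>n. (-1) ^ n / of_real (real n + x) powr w) sums E w" if "Re w > 0" for w
    using euler_sum_sums[OF assms(1) that] E[of 1 w] that by simp
  ultimately have "alt_hurwitz_zeta z x = E z" by (rule alt_hurwitz_zeta_unique[OF assms(1)])
  thus ?thesis using E assms by simp
qed

lemma alt_hurwitz_zeta_sums:
  assumes "x > 0" and "Re z > 0"
  shows "(\<lambda>n. (-1) ^ n / of_real (real n + x) powr z) sums alt_hurwitz_zeta z x"
  using euler_sum_sums[OF assms] alt_hurwitz_zeta_eq_euler_sum[OF assms(1), of 1 z] assms by simp

lemma alt_hurwitz_zeta_of_nat_sums:
  assumes "x > 0" and "m > 0"
  shows "(\<lambda>n. (-1) ^ n / of_real (real n + x) ^ m) sums alt_hurwitz_zeta (of_nat m) x"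
proof -
  have nz: "complex_of_real (real n + x) \<noteq> 0" for n
    using assms by (metis add.commute add_nonneg_pos of_nat_0_le_iff of_real_eq_0_iff order_less_irrefl)
  show ?thesis
    using alt_hurwitz_zeta_sums[OF assms(1), of "of_nat m"] assms(2)
    using nz by (simp add: powr_nat')
qed

text \<open>For exponent 0 all differences of the constant function vanish, and only the boundary
  term \<open>j = 0\<close> of the Euler transform remains.\<close>

lemma alt_hurwitz_zeta_0:
  assumes "x > 0"
  shows "alt_hurwitz_zeta 0 x = 1 / 2"
proof -
  have p: "npow 0 y = 1" if "y > 0" for y using that by (simp add: npow_def)
  have "fdiff (fdiff (npow 0)) y = 0" "fdiff (npow 0) y = 0" if "y > 0" for y
    using that by (simp_all add: fdiff_def p)
  thus ?thesis
    using alt_hurwitz_zeta_eq_euler_sum[OF assms, of 2 0] assms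
    by (simp add: euler_sum_def p numeral_2_eq_2)
qed

subsection \<open>A Mellin--Barnes integral\<close>

lemma norm_sin_squared_sinh: "norm (sin z) ^ 2 = sin (Re z) ^ 2 + sinh (Im z) ^ 2"
proof -
  have "norm (sin z) ^ 2 = norm (cos (of_real pi / 2 - z)) ^ 2"
    by (simp add: sin_cos_eq)
  also have "\<dots> = sin (Re z) ^ 2 + ((exp (Im z) - exp (- Im z)) / 2) ^ 2"
    by (simp add: norm_cos_squared sin_cos_eq exp_minus power_divide power2_commute)
  finally show ?thesis by (simp add: sinh_field_def)
qed

text \<open>For the horizontal sides of the contour: there the real part passes over a zero of the
  sine, and the imaginary part alone must supply the bound.\<close>

lemma norm_sin_ge_sinh: "norm (sin z) \<ge> \<bar>sinh (Im z)\<bar>"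
  by (rule power2_le_imp_le) (simp_all add: norm_sin_squared_sinh)

text \<open>For vertical lines, where the real part is fixed. The squares of the two sides differ by
  \<open>sinh (Im z) ^ 2 * cos (Re z) ^ 2\<close>.\<close>

lemma norm_sin_ge_cosh: "norm (sin z) \<ge> \<bar>sin (Re z)\<bar> * cosh (Im z)"
proof (rule power2_le_imp_le)
  have "norm (sin z) ^ 2 - (\<bar>sin (Re z)\<bar> * cosh (Im z)) ^ 2 = sinh (Im z) ^ 2 * cos (Re z) ^ 2"
    by (simp add: norm_sin_squared_sinh power_mult_distrib cosh_square_eq cos_squared_eq algebra_simps)
  moreover have "\<dots> \<ge> 0" by simp
  ultimately show "(\<bar>sin (Re z)\<bar> * cosh (Im z)) ^ 2 \<le> norm (sin z) ^ 2" by linarith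
qed simp

text \<open>With \<open>u = \<kappa> * \<bar>t\<bar>\<close>, the inequality
  \<open>u / 4 \<le> exp (u / 4)\<close> gives
  \<open>u ^ 4 \<le> 256 * exp u \<le> 512 * cosh u\<close>, whence the constant
  \<open>1024 = 2 * 512\<close>.\<close>

lemma quartic_over_cosh_bound:
  assumes "\<kappa> > (0::real)"
  shows "(1 + t\<^sup>2) ^ 2 / cosh (\<kappa> * t) \<le> 2 + 1024 / \<kappa> ^ 4"
proof -
  define u where "u = \<kappa> * \<bar>t\<bar>"
  have u: "u \<ge> 0" using assms by (simp add: u_def)
  have "(u / 4) ^ 4 \<le> exp (u / 4) ^ 4"
    using u exp_ge_add_one_self[of "u / 4"] by (intro power_mono) linarith+
  also have "\<dots> = exp u"
    using exp_of_nat_mult[of 4 "u / 4"] by simp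
  also have "exp u \<le> 2 * cosh u" by (simp add: cosh_field_def)
  also have "cosh u = cosh (\<kappa> * t)" by (simp add: u_def abs_if)
  finally have "\<kappa> ^ 4 * t ^ 4 \<le> 512 * cosh (\<kappa> * t)"
    by (simp add: u_def power_mult_distrib power_divide)
  hence t4: "t ^ 4 \<le> 512 / \<kappa> ^ 4 * cosh (\<kappa> * t)"
    using assms by (simp add: field_simps)
  have "(1 + t\<^sup>2) ^ 2 = 2 + 2 * t ^ 4 - (1 - t\<^sup>2) ^ 2"
    by (simp add: power2_eq_square power4_eq_xxxx algebra_simps)
  also have "\<dots> \<le> 2 * 1 + 2 * t ^ 4" by simp
  also have "\<dots> \<le> 2 * cosh (\<kappa> * t) + 2 * (512 / \<kappa> ^ 4 * cosh (\<kappa> * t))"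
    using t4 cosh_real_ge_1[of "\<kappa> * t"] by (intro add_mono mult_left_mono) auto
  finally have "(1 + t\<^sup>2) ^ 2 \<le> (2 + 1024 / \<kappa> ^ 4) * cosh (\<kappa> * t)"
    by (simp add: algebra_simps)
  thus ?thesis by (simp add: pos_divide_le_eq cosh_real_pos)
qed

section \<open>Integrable majorants on vertical lines\<close>

lemma integrable_lborel_inverse_1_plus_square: "integrable lborel (\<lambda>t::real. 1 / (1 + t\<^sup>2))"
  using integrable_inverse_1_plus_square by (simp add: set_integrable_def einterval_def inverse_eq_divide)

text \<open>The quadratic factor accounts for the growth in \<open>t\<close> of the second
  differences of \<open>npow\<close>; the quartic bound leaves \<open>1 / (1 + t\<^sup>2)\<close> as
  majorant.\<close>

lemma quadratic_over_cosh_integrable: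
  assumes "\<kappa> > (0::real)"
  shows "integrable lborel (\<lambda>t. (1 + t\<^sup>2) / cosh (\<kappa> * t))"
proof (rule Bochner_Integration.integrable_bound)
  show "integrable lborel (\<lambda>t. (2 + 1024 / \<kappa> ^ 4) * (1 / (1 + t\<^sup>2)))"
    by (intro integrable_mult_right integrable_lborel_inverse_1_plus_square)
  show "(\<lambda>t. (1 + t\<^sup>2) / cosh (\<kappa> * t)) \<in> borel_measurable lborel"
  proof -
    have "continuous_on UNIV (\<lambda>t. (1 + t\<^sup>2) / cosh (\<kappa> * t))"
      by (intro continuous_intros) (simp add: cosh_real_nonzero)
    from borel_measurable_continuous_onI[OF this] show ?thesis by simp
  qed
  show "AE t in lborel. norm ((1 + t\<^sup>2) / cosh (\<kappa> * t)) \<le> norm ((2 + 1024 / \<kappa> ^ 4) * (1 / (1 + t\<^sup>2)))"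
  proof (rule AE_I2)
    fix t :: real
    have pos: "1 + t\<^sup>2 > 0" by (simp add: add_pos_nonneg)
    have "(1 + t\<^sup>2) / cosh (\<kappa> * t) = (1 + t\<^sup>2) ^ 2 / cosh (\<kappa> * t) * (1 / (1 + t\<^sup>2))"
      using pos by (simp add: power2_eq_square)
    also have "\<dots> \<le> (2 + 1024 / \<kappa> ^ 4) * (1 / (1 + t\<^sup>2))"
      using quartic_over_cosh_bound[OF assms, of t] pos by (intro mult_right_mono) auto
    finally show "norm ((1 + t\<^sup>2) / cosh (\<kappa> * t)) \<le> norm ((2 + 1024 / \<kappa> ^ 4) * (1 / (1 + t\<^sup>2)))"
      using pos assms by (simp add: cosh_real_pos less_imp_le abs_of_pos)
  qed
qed

section \<open>Integral of an exponential over a sine along a vertical line\<close>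

context
  fixes L d l :: real and h :: "complex \<Rightarrow> complex"
  assumes d: "0 < d" "d < L"
  defines "h \<equiv> \<lambda>w. exp (- of_real l * w) / sin (of_real (pi / L) * w)"
begin

text \<open>The zeros are the integer multiples of \<open>L\<close>. The strip of width
  \<open>2 * L\<close> contains both lines \<open>Re w = d\<close> and \<open>Re w = d + L\<close>
  and only the zero at \<open>L\<close>.\<close>

lemma exp_over_sin_denominator_nonzero:
  assumes "0 < Re w" "Re w < 2 * L" "w \<noteq> of_real L"
  shows "sin (of_real (pi / L) * w) \<noteq> 0"
proof
  assume "sin (of_real (pi / L) * w) = 0"
  then obtain n :: int where n: "of_real (pi / L) * w = of_real (of_int n * pi)"
    unfolding sin_eq_0 by auto
  have L: "L > 0" using d by simp
  have w: "w = of_real (of_int n * L)"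
    using n L by (simp add: field_simps)
  have "0 < of_int n * L" "of_int n * L < 2 * L"
    using assms unfolding w by simp_all
  hence "0 < n" "n < 2" using L by (simp_all add: zero_less_mult_iff)
  hence "n = 1" by simp
  thus False using w assms(3) by simp
qed

lemma exp_over_sin_holomorphic: "h holomorphic_on {w. 0 < Re w \<and> Re w < 2 * L} - {of_real L}"
  unfolding h_def using exp_over_sin_denominator_nonzero by (intro holomorphic_intros) auto

lemma exp_over_sin_shift: "h (w + of_real L) = - exp (- of_real (l * L)) * h w"
proof -
  have "sin (of_real (pi / L) * (w + of_real L)) = sin (of_real (pi / L) * w + of_real pi)"
    using d by (simp add: distrib_left)
  also have "\<dots> = - sin (of_real (pi / L) * w)" by (simp add: sin_add flip: cos_of_real sin_of_real)
  finally show ?thesis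
    unfolding h_def by (simp add: algebra_simps exp_diff exp_minus exp_add field_simps)
qed

lemma norm_exp_over_sin_le:
  "norm (h (Complex d t)) \<le> exp (- l * d) / sin (pi * d / L) * (1 / cosh (pi / L * t))"
proof -
  have s: "sin (pi * d / L) > 0"
    using d by (intro sin_gt_zero) (auto simp: field_simps)
  have "norm (sin (of_real (pi / L) * Complex d t)) \<ge> sin (pi * d / L) * cosh (pi / L * t)"
    using norm_sin_ge_cosh[of "of_real (pi / L) * Complex d t"] s by (simp add: abs_of_pos)
  thus ?thesis
    unfolding h_def norm_divide using s by (simp add: divide_simps cosh_real_pos cosh_real_nonzero)
qed

lemma continuous_exp_over_sin_line: "continuous_on UNIV (\<lambda>t. h (Complex d t))"
proof -
  have "sin (of_real (pi / L) * Complex d t) \<noteq> 0" for t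
    using d by (intro exp_over_sin_denominator_nonzero) (auto simp: complex_eq_iff)
  thus ?thesis unfolding h_def Complex_eq
    by (intro continuous_intros) (auto simp: Complex_eq)
qed

lemma exp_over_sin_line_integrable: "integrable lborel (\<lambda>t. h (Complex d t))"
proof (rule Bochner_Integration.integrable_bound)
  \<comment> \<open>The factor \<open>1 + t\<^sup>2\<close> only enlarges the majorant and makes
    \<open>quadratic_over_cosh_integrable\<close> applicable.\<close>
  show "integrable lborel (\<lambda>t. exp (- l * d) / sin (pi * d / L) * ((1 + t\<^sup>2) / cosh (pi / L * t)))"
    using d by (intro integrable_mult_right quadratic_over_cosh_integrable) auto
  show "(\<lambda>t. h (Complex d t)) \<in> borel_measurable lborel"
    using borel_measurable_continuous_onI[OF continuous_exp_over_sin_line] by simp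
  show "AE t in lborel. norm (h (Complex d t))
          \<le> norm (exp (- l * d) / sin (pi * d / L) * ((1 + t\<^sup>2) / cosh (pi / L * t)))"
  proof (rule AE_I2)
    fix t :: real
    have s: "sin (pi * d / L) > 0"
      using d by (intro sin_gt_zero) (auto simp: field_simps)
    have "norm (h (Complex d t)) \<le> exp (- l * d) / sin (pi * d / L) * (1 / cosh (pi / L * t))"
      by (rule norm_exp_over_sin_le)
    also have "\<dots> \<le> exp (- l * d) / sin (pi * d / L) * ((1 + t\<^sup>2) / cosh (pi / L * t))"
      using s by (intro mult_left_mono divide_right_mono) (auto simp: cosh_real_pos less_imp_le)
    finally show "norm (h (Complex d t))
          \<le> norm (exp (- l * d) / sin (pi * d / L) * ((1 + t\<^sup>2) / cosh (pi / L * t)))"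
      by (rule order_trans) (unfold real_norm_def, rule abs_ge_self)
  qed
qed

lemma residue_exp_over_sin: "residue h (of_real L) = - of_real (L / pi) * exp (- of_real (l * L))"
proof -
  have "residue h (of_real L) = exp (- of_real l * of_real L) / (- of_real (pi / L))"
    unfolding h_def
  proof (rule residue_simple_pole_deriv[where s = UNIV])
    have "((\<lambda>w. sin (of_real (pi / L) * w)) has_field_derivative
             of_real (pi / L) * cos (of_real (pi / L) * of_real L)) (at (of_real L :: complex))"
      by (auto intro!: derivative_eq_intros)
    also have "cos (of_real (pi / L) * of_real L :: complex) = - 1"
      using d by (simp flip: cos_of_real)
    finally show "((\<lambda>w. sin (of_real (pi / L) * w)) has_field_derivative - of_real (pi / L)) (at (of_real L :: complex))"
      by simp
    show "sin (complex_of_real (pi / L) * complex_of_real L) = 0"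
      using d by (simp flip: sin_of_real)
  qed (use d in \<open>auto intro!: holomorphic_intros\<close>)
  thus ?thesis using d by (simp add: field_simps)
qed

text \<open>The endpoints and \<open>r\<close> are left open so that one statement serves the top
  and the bottom side in either direction. The exponential is bounded on the strip, and the sine
  grows like \<open>sinh\<close>.\<close>

lemma exp_over_sin_horizontal_bound:
  assumes "a \<in> {d, d + L}" "b \<in> {d, d + L}" "\<bar>r\<bar> = R" "R > 0"
  shows "h contour_integrable_on linepath (Complex a r) (Complex b r)"
    and "norm (contour_integral (linepath (Complex a r) (Complex b r)) h)
           \<le> exp (\<bar>l\<bar> * (2 * L)) / sinh (pi / L * R) * L"
proof -
  have L: "L > 0" using d by simp
  have seg: "closed_segment (Complex a r) (Complex b r) \<subseteq> {w. Im w = r \<and> 0 < Re w \<and> Re w < 2 * L}"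
    using assms d by (auto simp: closed_segment_same_Im closed_segment_eq_real_ivl split: if_splits)
  have cont: "continuous_on (closed_segment (Complex a r) (Complex b r)) h"
    by (rule continuous_on_subset[OF holomorphic_on_imp_continuous_on[OF exp_over_sin_holomorphic]])
       (use seg assms in auto)
  show int: "h contour_integrable_on linepath (Complex a r) (Complex b r)"
    by (rule contour_integrable_continuous_linepath[OF cont])
  have pos: "sinh (pi / L * R) > 0" using L assms by simp
  have "norm (contour_integral (linepath (Complex a r) (Complex b r)) h)
     \<le> exp (\<bar>l\<bar> * (2 * L)) / sinh (pi / L * R) * norm (Complex b r - Complex a r)"
  proof (rule contour_integral_bound_linepath[OF int])
    fix w assume "w \<in> closed_segment (Complex a r) (Complex b r)"
    hence w: "Im w = r" "0 < Re w" "Re w < 2 * L" using seg by auto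
    have "sinh (pi / L * r) = sinh (pi / L * R) \<or> sinh (pi / L * r) = - sinh (pi / L * R)"
      using assms by (auto simp: abs_if split: if_splits)
    hence "\<bar>sinh (pi / L * r)\<bar> = sinh (pi / L * R)"
      using pos by auto
    hence "norm (sin (of_real (pi / L) * w)) \<ge> sinh (pi / L * R)"
      using norm_sin_ge_sinh[of "of_real (pi / L) * w"] w by simp
    moreover have "norm (exp (- of_real l * w)) \<le> exp (\<bar>l\<bar> * (2 * L))"
    proof -
      have "- (l * Re w) \<le> \<bar>l\<bar> * Re w" using w by (simp add: abs_if)
      also have "\<dots> \<le> \<bar>l\<bar> * (2 * L)" using w by (intro mult_left_mono) auto
      finally show ?thesis by simp
    qed
    ultimately show "norm (h w) \<le> exp (\<bar>l\<bar> * (2 * L)) / sinh (pi / L * R)"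
      unfolding h_def norm_divide using pos by (intro frac_le) auto
  qed (use pos in simp)
  also have "\<dots> \<le> exp (\<bar>l\<bar> * (2 * L)) / sinh (pi / L * R) * L"
  proof (rule mult_left_mono)
    show "norm (Complex b r - Complex a r) \<le> L"
      using assms L by (auto simp: cmod_def)
  qed (use pos in simp)
  finally show "norm (contour_integral (linepath (Complex a r) (Complex b r)) h)
           \<le> exp (\<bar>l\<bar> * (2 * L)) / sinh (pi / L * R) * L" .
qed

text \<open>The residue theorem on the rectangle between \<open>Re w = d\<close> and
  \<open>Re w = d + L\<close>. By \<open>exp_over_sin_shift\<close> the right side is a constant
  multiple of the left one, so both vertical sides combine to
  \<open>1 + exp (- of_real (l * L))\<close> times the wanted integral; the error consists of the
  two horizontal sides.\<close>

lemma exp_over_sin_rectangle_bound: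
  assumes "R > 0"
  shows "norm ((1 + exp (- of_real (l * L))) * integral {-R..R} (\<lambda>t. h (Complex d t))
            - of_real (2 * L) * exp (- of_real (l * L)))
          \<le> 2 * (exp (\<bar>l\<bar> * (2 * L)) / sinh (pi / L * R) * L)"
proof -
  have L: "L > 0" using d by simp
  define a1 a2 a3 a4 where
    "a1 = Complex d (-R)" and "a2 = Complex (d + L) (-R)" and
    "a3 = Complex (d + L) R" and "a4 = Complex d R"
  define E where "E = exp (- complex_of_real (l * L))"
  let ?V = "integral {-R..R} (\<lambda>t. h (Complex d t))"
  let ?S = "{w. 0 < Re w \<and> Re w < 2 * L}"
  let ?g = "rectpath a1 a3"
  have S: "open ?S" "convex ?S"
    using open_Int[OF open_halfspace_Re_gt[of 0] open_halfspace_Re_lt[of "2 * L"]]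
      convex_Int[OF convex_halfspace_Re_gt[of 0] convex_halfspace_Re_lt[of "2 * L"]]
    by (simp_all add: Int_def)
  have cont: "continuous_on (?S - {of_real L}) h"
    by (rule holomorphic_on_imp_continuous_on[OF exp_over_sin_holomorphic])
  have img: "path_image ?g \<subseteq> ?S - {of_real L}"
    using d assms unfolding a1_def a3_def by (subst path_image_rectpath) auto
  have "contour_integral ?g h = 2 * pi * \<i> * (\<Sum>p\<in>{of_real L}. winding_number ?g p * residue h p)"
  proof (rule Residue_theorem[OF S(1) convex_connected[OF S(2)]])
    show "h holomorphic_on ?S - {of_real L}" by (rule exp_over_sin_holomorphic)
    show "\<forall>z. z \<notin> ?S \<longrightarrow> winding_number ?g z = 0"
      using d assms by (auto intro!: winding_number_rectpath_outside simp: a1_def a3_def in_cbox_complex_iff)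
  qed (use img in auto)
  also have "winding_number ?g (of_real L) = 1"
    using d assms by (intro winding_number_rectpath) (auto simp: in_box_complex_iff a1_def a3_def)
  hence "2 * pi * \<i> * (\<Sum>p\<in>{of_real L}. winding_number ?g p * residue h p)
      = - \<i> * of_real (2 * L) * E"
    by (simp add: residue_exp_over_sin E_def)
  finally have res: "contour_integral ?g h = - \<i> * of_real (2 * L) * E" .
  have right_left: "contour_integral (linepath a2 a3) h = - E * contour_integral (linepath a1 a4) h"
  proof -
    have "contour_integral (linepath a2 a3) h = \<i> * integral {-R..R} (\<lambda>t. h (Complex (d + L) t))"
      using assms by (intro contour_integral_linepath_same_Re) (auto simp: a2_def a3_def)
    also have "(\<lambda>t. h (Complex (d + L) t)) = (\<lambda>t. - E * h (Complex d t))"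
    proof
      fix t
      have "Complex (d + L) t = Complex d t + of_real L" by (simp add: complex_eq_iff)
      thus "h (Complex (d + L) t) = - E * h (Complex d t)" by (simp only: exp_over_sin_shift E_def)
    qed
    also have "integral {-R..R} \<dots> = - E * ?V" by simp
    also have "\<i> * (- E * ?V) = - E * (\<i> * ?V)" by simp
    also have "\<i> * ?V = contour_integral (linepath a1 a4) h"
      using assms by (intro contour_integral_linepath_same_Re[symmetric]) (auto simp: a1_def a4_def)
    finally show ?thesis .
  qed
  have left: "contour_integral (linepath a1 a4) h = \<i> * ?V"
    using assms by (intro contour_integral_linepath_same_Re) (auto simp: a1_def a4_def)
  have vert: "continuous_on (closed_segment a2 a3) h" "continuous_on (closed_segment a4 a1) h"
  proof -
    have "closed_segment a2 a3 \<subseteq> ?S - {of_real L}" "closed_segment a4 a1 \<subseteq> ?S - {of_real L}"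
      using d unfolding a1_def a2_def a3_def a4_def
      by (auto simp: closed_segment_same_Re)
    thus "continuous_on (closed_segment a2 a3) h" "continuous_on (closed_segment a4 a1) h"
      using cont continuous_on_subset by blast+
  qed
  have hor: "h contour_integrable_on linepath a1 a2"
            "h contour_integrable_on linepath a3 a4"
     and hb: "norm (contour_integral (linepath a1 a2) h) \<le> exp (\<bar>l\<bar> * (2 * L)) / sinh (pi / L * R) * L"
             "norm (contour_integral (linepath a3 a4) h) \<le> exp (\<bar>l\<bar> * (2 * L)) / sinh (pi / L * R) * L"
    unfolding a1_def a2_def a3_def a4_def using assms by (intro exp_over_sin_horizontal_bound; simp)+
  have "contour_integral ?g h = contour_integral (linepath a1 a2) h + contour_integral (linepath a2 a3) h
     + contour_integral (linepath a3 a4) h + contour_integral (linepath a4 a1) h"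
    using hor contour_integrable_continuous_linepath[OF vert(1)] contour_integrable_continuous_linepath[OF vert(2)]
    by (simp add: rectpath_def Let_def a1_def a2_def a3_def a4_def valid_path_join contour_integrable_join)
  also have "contour_integral (linepath a4 a1) h = - contour_integral (linepath a1 a4) h"
    by (rule contour_integral_reverse_linepath[OF vert(2)])
  \<comment> \<open>The left side is traversed downwards and so enters with a minus sign; moving
    both vertical contributions across leaves the horizontal sides alone.\<close>
  finally have "- \<i> * of_real (2 * L) * E + (1 + E) * (\<i> * ?V) =
      contour_integral (linepath a1 a2) h + contour_integral (linepath a3 a4) h"
    unfolding res right_left left by (simp add: algebra_simps)
  hence "\<i> * ((1 + E) * ?V - of_real (2 * L) * E)
      = contour_integral (linepath a1 a2) h + contour_integral (linepath a3 a4) h"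
    by (simp add: algebra_simps)
  hence "norm ((1 + E) * ?V - of_real (2 * L) * E)
      = norm (contour_integral (linepath a1 a2) h + contour_integral (linepath a3 a4) h)"
    by (metis norm_ii norm_mult mult_1)
  also have "\<dots> \<le> 2 * (exp (\<bar>l\<bar> * (2 * L)) / sinh (pi / L * R) * L)"
    using hb norm_triangle_ineq[of "contour_integral (linepath a1 a2) h"] by (smt (verit))
  finally show ?thesis unfolding E_def .
qed

text \<open>Letting the height of the rectangle tend to infinity removes the horizontal sides and
  leaves a linear equation for the integral, with the positive coefficient
  \<open>1 + exp (- (l * L))\<close>.\<close>

lemma exp_over_sin_line_integral: "(LBINT t. h (Complex d t)) = of_real (2 * L / (exp (l * L) + 1))"
proof -
  have L: "L > 0" using d by simp
  define E where "E = exp (- complex_of_real (l * L))"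
  define V where "V n = integral {- real n..real n} (\<lambda>t. h (Complex d t))" for n :: nat
  let ?I = "LBINT t. h (Complex d t)"
  \<comment> \<open>Dominated convergence identifies the limit of the symmetric truncations with the
    Lebesgue integral.\<close>
  have "(\<lambda>n. LBINT t. indicator {- real n..real n} t *\<^sub>R h (Complex d t)) \<longlonglongrightarrow> ?I"
  proof (rule integral_dominated_convergence)
    show "integrable lborel (\<lambda>t. norm (h (Complex d t)))"
      using exp_over_sin_line_integrable by simp
    show "AE t in lborel. (\<lambda>n. indicator {- real n..real n} t *\<^sub>R h (Complex d t)) \<longlonglongrightarrow> h (Complex d t)"
    proof (rule AE_I2)
      fix t :: real
      obtain N :: nat where N: "real N > \<bar>t\<bar>" using reals_Archimedean2 by blast
      have "indicator {- real n..real n} t *\<^sub>R h (Complex d t) = h (Complex d t)" if "n \<ge> N" for n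
        using N that by (auto simp: indicator_def)
      thus "(\<lambda>n. indicator {- real n..real n} t *\<^sub>R h (Complex d t)) \<longlonglongrightarrow> h (Complex d t)"
        by (intro tendsto_eventually) (auto simp: eventually_sequentially)
    qed
  qed (use exp_over_sin_line_integrable in \<open>auto simp: indicator_def intro!: borel_measurable_scaleR\<close>)
  moreover have "(LBINT t. indicator {- real n..real n} t *\<^sub>R h (Complex d t)) = V n" for n
  proof -
    have "set_integrable lborel {- real n..real n} (\<lambda>t. h (Complex d t))"
      unfolding set_integrable_def by (rule integrable_mult_indicator) (use exp_over_sin_line_integrable in auto)
    from set_borel_integral_eq_integral(2)[OF this] show ?thesis
      by (simp add: V_def set_lebesgue_integral_def)
  qed
  ultimately have V: "V \<longlonglongrightarrow> ?I" by simp
  hence "(\<lambda>n. (1 + E) * V n - of_real (2 * L) * E) \<longlonglongrightarrow> (1 + E) * ?I - of_real (2 * L) * E"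
    by (intro tendsto_intros)
  moreover have "(\<lambda>n. (1 + E) * V n - of_real (2 * L) * E) \<longlonglongrightarrow> 0"
  proof (rule Lim_null_comparison)
    show "\<forall>\<^sub>F n in sequentially. norm ((1 + E) * V n - of_real (2 * L) * E)
            \<le> 2 * (exp (\<bar>l\<bar> * (2 * L)) / sinh (pi / L * real n) * L)"
      using eventually_gt_at_top[of 0]
      by eventually_elim (use exp_over_sin_rectangle_bound in \<open>simp add: E_def V_def\<close>)
    have "filterlim (\<lambda>n. sinh (pi / L * real n)) at_top sequentially"
      using L by (intro filterlim_compose[OF sinh_real_at_top]
         filterlim_tendsto_pos_mult_at_top[OF tendsto_const _ filterlim_real_sequentially]) auto
    from tendsto_divide_0[OF tendsto_const filterlim_at_top_imp_at_infinity[OF this]]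
    have "(\<lambda>n. exp (\<bar>l\<bar> * (2 * L)) / sinh (pi / L * real n)) \<longlonglongrightarrow> 0" .
    from tendsto_mult_right[OF tendsto_mult_left[OF this], of 2 L]
    show "(\<lambda>n. 2 * (exp (\<bar>l\<bar> * (2 * L)) / sinh (pi / L * real n) * L)) \<longlonglongrightarrow> 0"
      by (simp add: mult.assoc)
  qed
  ultimately have "(1 + E) * ?I = of_real (2 * L) * E"
    using LIMSEQ_unique by fastforce
  moreover have E: "E = of_real (inverse (exp (l * L)))"
    by (simp add: E_def exp_minus exp_of_real del: of_real_mult)
  ultimately have "of_real (1 + inverse (exp (l * L))) * ?I = complex_of_real (2 * L * inverse (exp (l * L)))"
    by simp
  moreover have "1 + inverse (exp (l * L)) > 0" by (simp add: add_pos_pos)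
  ultimately have "?I = of_real (2 * L * inverse (exp (l * L)) / (1 + inverse (exp (l * L))))"
    by (simp add: field_simps del: of_real_inverse of_real_add)
  also have "2 * L * inverse (exp (l * L)) / (1 + inverse (exp (l * L))) = 2 * L / (exp (l * L) + 1)"
    by (simp add: field_simps)
  finally show ?thesis .
qed

end

subsection \<open>Closed form of the kernel\<close>

text \<open>The factor of the kernel integrand at \<open>s = c + \<i> t\<close> that does not involve the zeta function.\<close>

definition mellin_barnes_weight :: "real \<Rightarrow> real \<Rightarrow> nat \<Rightarrow> real \<Rightarrow> complex" where
  "mellin_barnes_weight c x k t = (let s = Complex c t in
     1 / (2 * of_nat k * cos (of_real pi * (s + of_nat k - 1) / (2 * of_nat k))) * of_real x powr (- s))"

context
  fixes c x :: real and k :: nat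
  assumes c: "1 < c" "c < 2" and x: "x > 0" and k: "k \<ge> 1"
begin

text \<open>The substitution \<open>w = s - 1\<close> moves the argument of the cosine to
  \<open>pi / 2\<close> plus a multiple of \<open>w\<close>, which turns it into minus a sine, and
  the powers combine to \<open>(x / A) powr (- w) / x\<close>. This is the earlier integrand with
  \<open>d = c - 1\<close>, \<open>L = 2 * k\<close> and \<open>l = ln (x / A)\<close>.\<close>

lemma npow_mellin_barnes_weight:
  assumes "A > 0"
  shows "npow (1 - Complex c t) A * mellin_barnes_weight c x k t =
     - of_real (1 / (2 * real k * x)) * (exp (- of_real (ln (x / A)) * Complex (c - 1) t)
         / sin (of_real (pi / real (2 * k)) * Complex (c - 1) t))"
proof -
  define w where "w = Complex (c - 1) t"
  have s: "Complex c t = w + 1" by (simp add: w_def complex_eq_iff)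
  have "of_real pi * (Complex c t + of_nat k - 1) / (2 * of_nat k)
      = of_real (pi / real (2 * k)) * w + of_real pi / 2"
    using k by (simp add: s field_simps)
  hence "cos (of_real pi * (Complex c t + of_nat k - 1) / (2 * of_nat k))
      = - sin (of_real (pi / real (2 * k)) * w)"
    by (simp add: minus_sin_cos_eq)
  moreover have "npow (1 - Complex c t) A = exp (w * of_real (ln A))"
    using assms by (simp add: npow_def s powr_def Ln_of_real)
  moreover have "of_real x powr (- Complex c t) = of_real (1 / x) * exp (- w * of_real (ln x))"
    using x by (simp add: s powr_def Ln_of_real exp_diff exp_minus exp_of_real field_simps exp_add)
  moreover have "exp (w * of_real (ln A)) * exp (- w * of_real (ln x)) = exp (- of_real (ln (x / A)) * w)"
    using assms x by (simp add: ln_div algebra_simps flip: exp_add)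
  ultimately show ?thesis
    unfolding mellin_barnes_weight_def Let_def w_def[symmetric] by (simp add: field_simps)
qed

lemma mellin_barnes_weight_npow_integrable:
  assumes "A > 0"
  shows "integrable lborel (\<lambda>t. npow (1 - Complex c t) A * mellin_barnes_weight c x k t)"
  unfolding npow_mellin_barnes_weight[OF assms]
  using c k by (intro integrable_mult_right exp_over_sin_line_integrable) auto

text \<open>The value is split into a part that decays in \<open>A\<close> and a constant, because
  differences in \<open>A\<close> annihilate the constant.\<close>

lemma mellin_barnes_weight_npow_integral:
  assumes "A > 0"
  shows "(LBINT t. npow (1 - Complex c t) A * mellin_barnes_weight c x k t) =
     of_real (2 * pi * (x ^ (2 * k - 1) / (pi * (A ^ (2 * k) + x ^ (2 * k))) - 1 / (pi * x)))"
proof -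
  have "exp (ln (x / A) * real (2 * k)) = (x / A) ^ (2 * k)"
    using assms x exp_of_nat_mult[of "2 * k" "ln (x / A)"] by (simp add: mult.commute del: of_nat_mult)
  hence "(LBINT t. npow (1 - Complex c t) A * mellin_barnes_weight c x k t) =
     - of_real (1 / (2 * real k * x)) * of_real (2 * real (2 * k) / ((x / A) ^ (2 * k) + 1))"
    unfolding npow_mellin_barnes_weight[OF assms] integral_mult_right_zero
    using c k exp_over_sin_line_integral[of "c - 1" "real (2 * k)" "ln (x / A)"] by simp
  also have "\<dots> = of_real (- (1 / (2 * real k * x)) * (2 * real (2 * k) / ((x / A) ^ (2 * k) + 1)))"
    by simp
  also have "- (1 / (2 * real k * x)) * (2 * real (2 * k) / ((x / A) ^ (2 * k) + 1))
     = 2 * pi * (x ^ (2 * k - 1) / (pi * (A ^ (2 * k) + x ^ (2 * k))) - 1 / (pi * x))"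
  proof -
    have pos: "A ^ (2 * k) + x ^ (2 * k) > 0" "A ^ (2 * k) > 0" using assms x by (auto intro: add_pos_pos)
    have xk: "x ^ (2 * k - 1) = x ^ (2 * k) / x"
      using x k by (simp add: power_diff)
    have "- (1 / (2 * real k * x)) * (2 * real (2 * k) / ((x / A) ^ (2 * k) + 1))
        = - (2 / x) * (1 / ((x / A) ^ (2 * k) + 1))" using k by simp
    also have "1 / ((x / A) ^ (2 * k) + 1) = A ^ (2 * k) / (A ^ (2 * k) + x ^ (2 * k))"
    proof -
      have "(x / A) ^ (2 * k) + 1 = (A ^ (2 * k) + x ^ (2 * k)) / A ^ (2 * k)"
        using pos assms by (simp add: power_divide add_divide_distrib add.commute)
      thus ?thesis by simp
    qed
    also have "- (2 / x) * \<dots> = 2 * pi * (x ^ (2 * k - 1) / (pi * (A ^ (2 * k) + x ^ (2 * k))) - 1 / (pi * x))"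
    proof -
      have 1: "2 * pi * (u / x / (pi * w) - 1 / (pi * x)) = 2 / x * (u / w - 1)" for u w
        by (simp add: right_diff_distrib)
      have 2: "x ^ (2 * k) / (A ^ (2 * k) + x ^ (2 * k)) - 1 = - (A ^ (2 * k) / (A ^ (2 * k) + x ^ (2 * k)))"
        using pos by (simp add: divide_simps)
      show ?thesis unfolding xk 1 2 by simp
    qed
    finally show ?thesis .
  qed
  finally show ?thesis .
qed

text \<open>The case \<open>A = 1\<close> of \<open>npow_mellin_barnes_weight\<close>, where the
  power equals 1.\<close>

lemma norm_mellin_barnes_weight_le:
  "norm (mellin_barnes_weight c x k t) \<le> 1 / (2 * real k * x) * exp (- ln x * (c - 1)) / sin (pi * (c - 1) / real (2 * k))
      * (1 / cosh (pi / real (2 * k) * t))"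
proof -
  have "norm (mellin_barnes_weight c x k t) = norm (npow (1 - Complex c t) 1 * mellin_barnes_weight c x k t)"
    by (simp add: npow_def)
  also have "\<dots> = 1 / (2 * real k * x) * norm (exp (- of_real (ln x) * Complex (c - 1) t)
         / sin (of_real (pi / real (2 * k)) * Complex (c - 1) t))"
    using npow_mellin_barnes_weight[of 1 t] x by (simp add: norm_mult norm_divide)
  also have "\<dots> \<le> 1 / (2 * real k * x) * (exp (- ln x * (c - 1)) / sin (pi * (c - 1) / real (2 * k))
      * (1 / cosh (pi / real (2 * k) * t)))"
    using x c k norm_exp_over_sin_le[of "c - 1" "real (2 * k)" "ln x" t] by (intro mult_left_mono) auto
  finally show ?thesis by simp
qed

definition kernel_term :: "real \<Rightarrow> complex"
  where "kernel_term A = of_real (x ^ (2 * k - 1) / (pi * (A ^ (2 * k) + x ^ (2 * k))))"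

text \<open>Two Euler steps are applied under the integral, where they make termwise integration
  legitimate, and are then undone by \<open>sums_fdiff\<close> for the integrated terms. The
  constant \<open>C\<close> survives only in the boundary term of weight 1/2.\<close>

lemma alt_hurwitz_kernel_eq_alternating_sum:
  fixes a :: real
  assumes a: "a > 0" 
    and S: "(\<lambda>n. (-1) ^ n * kernel_term (real n + a)) sums S"
  shows "alt_hurwitz_kernel c x a k = S - of_real (1 / (2 * pi * x))"
proof -
  let ?W = "mellin_barnes_weight c x k"
  define z where "z t = 1 - Complex c t" for t
  define J where "J A = (LBINT t. npow (z t) A * ?W t)" for A
  define C where "C = complex_of_real (1 / (pi * x))"
  have int: "integrable lborel (\<lambda>t. npow (z t) A * ?W t)" if "A > 0" for A
    using mellin_barnes_weight_npow_integrable[OF that] by (simp add: z_def)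
  have J: "J A = 2 * pi * (kernel_term A - C)" if "A > 0" for A
    using mellin_barnes_weight_npow_integral[OF that] by (simp add: J_def z_def kernel_term_def C_def)
  \<comment> \<open>From the first difference on the constant \<open>C\<close> has
    cancelled.\<close>
  have d1: "integrable lborel (\<lambda>t. fdiff (npow (z t)) A * ?W t)"
           "(LBINT t. fdiff (npow (z t)) A * ?W t) = 2 * pi * fdiff kernel_term A" if "A > 0" for A
  proof -
    have eq: "fdiff (npow (z t)) A * ?W t = npow (z t) A * ?W t - npow (z t) (A + 1) * ?W t" for t
      by (simp add: fdiff_def algebra_simps)
    show "integrable lborel (\<lambda>t. fdiff (npow (z t)) A * ?W t)"
      unfolding eq using that by (intro Bochner_Integration.integrable_diff int) auto
    have "(LBINT t. fdiff (npow (z t)) A * ?W t) = J A - J (A + 1)"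
      unfolding eq J_def using that by (intro Bochner_Integration.integral_diff int) auto
    thus "(LBINT t. fdiff (npow (z t)) A * ?W t) = 2 * pi * fdiff kernel_term A"
      using that J[of A] J[of "A + 1"] by (simp add: fdiff_def algebra_simps)
  qed
  have d2: "integrable lborel (\<lambda>t. fdiff (fdiff (npow (z t))) A * ?W t)"
           "(LBINT t. fdiff (fdiff (npow (z t))) A * ?W t) = 2 * pi * fdiff (fdiff kernel_term) A" if "A > 0" for A
  proof -
    have eq: "fdiff (fdiff (npow (z t))) A * ?W t
        = fdiff (npow (z t)) A * ?W t - fdiff (npow (z t)) (A + 1) * ?W t" for t
      by (simp add: fdiff_def[of "fdiff _"] algebra_simps)
    show "integrable lborel (\<lambda>t. fdiff (fdiff (npow (z t))) A * ?W t)"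
      unfolding eq using that by (intro Bochner_Integration.integrable_diff d1) auto
    have "(LBINT t. fdiff (fdiff (npow (z t))) A * ?W t)
        = (LBINT t. fdiff (npow (z t)) A * ?W t) - (LBINT t. fdiff (npow (z t)) (A + 1) * ?W t)"
      unfolding eq using that by (intro Bochner_Integration.integral_diff d1) auto
    thus "(LBINT t. fdiff (fdiff (npow (z t))) A * ?W t) = 2 * pi * fdiff (fdiff kernel_term) A"
      using that d1(2)[of A] d1(2)[of "A + 1"] by (simp add: fdiff_def[of "fdiff _"] algebra_simps)
  qed
  define f where "f n t = (-1) ^ n * (fdiff (fdiff (npow (z t))) (real n + a) * ?W t)" for n :: nat and t
  have Rez: "Re (z t) = 1 - c" for t by (simp add: z_def)
  define K where "K = 1 / (2 * real k * x) * exp (- ln x * (c - 1)) / sin (pi * (c - 1) / real (2 * k))"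
  have s: "sin (pi * (c - 1) / real (2 * k)) > 0"
  proof (rule sin_gt_zero)
    have "pi * (c - 1) < pi * real (2 * k)"
      using c k by (intro mult_strict_left_mono) auto
    thus "pi * (c - 1) / real (2 * k) < pi" using k by (simp add: pos_divide_less_eq)
  qed (use c k in simp)
  have K: "K > 0" using s x k by (simp add: K_def)
  \<comment> \<open>The variables \<open>n\<close> and \<open>t\<close> are separated. The exponent
    is \<open>- Re (z t) - 2 = c - 3\<close>, which is below -1 because \<open>c < 2\<close>; the
    factor \<open>2 * (1 + t\<^sup>2)\<close> bounds
    \<open>norm (z t) * norm (z t + 1)\<close>.\<close>
  have nf: "norm (f n t) \<le> (real n + a) powr (c - 3) * (2 * K * ((1 + t\<^sup>2) / cosh (pi / real (2 * k) * t)))" for n t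
  proof -
    have ch: "cosh (pi / real (2 * k) * t) > 0" by (rule cosh_real_pos)
    have "norm (fdiff (fdiff (npow (z t))) (real n + a))
        \<le> norm (z t) * norm (z t + 1) * (real n + a) powr (c - 3)"
      using norm_funpow_fdiff_npow_le[where M = 2 and z = "z t" and x = "real n + a"] a c
      by (simp add: Rez numeral_2_eq_2)
    also have "norm (z t) * norm (z t + 1) \<le> (1 + \<bar>t\<bar>) * (1 + \<bar>t\<bar>)"
      using c by (intro mult_mono) (auto simp: z_def intro: order_trans[OF cmod_le])
    also have "\<dots> \<le> 2 * (1 + t\<^sup>2)"
      using zero_le_power2[of "1 - \<bar>t\<bar>"] by (simp add: power2_eq_square algebra_simps)
    finally have "norm (fdiff (fdiff (npow (z t))) (real n + a)) \<le> 2 * (1 + t\<^sup>2) * (real n + a) powr (c - 3)"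
      by (simp add: mult_right_mono)
    moreover have "norm (?W t) \<le> K * (1 / cosh (pi / real (2 * k) * t))"
      using norm_mellin_barnes_weight_le[of t] by (simp add: K_def)
    ultimately have "norm (f n t) \<le> 2 * (1 + t\<^sup>2) * (real n + a) powr (c - 3) * (K * (1 / cosh (pi / real (2 * k) * t)))"
      using mult_mono[of "norm (fdiff (fdiff (npow (z t))) (real n + a))" "2 * (1 + t\<^sup>2) * (real n + a) powr (c - 3)"
          "norm (?W t)" "K * (1 / cosh (pi / real (2 * k) * t))"]
      by (simp add: f_def norm_mult norm_power)
    thus ?thesis by (simp add: mult_ac)
  qed
  have fint: "integrable lborel (f n)" for n
    unfolding f_def using a by (intro integrable_mult_right d2) auto
  have fsum: "(\<lambda>n. LBINT t. f n t) sums (LBINT t. \<Sum>n. f n t)"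
   and fsint: "integrable lborel (\<lambda>t. \<Sum>n. f n t)"
  proof -
    let ?M = "LBINT t. 2 * K * ((1 + t\<^sup>2) / cosh (pi / real (2 * k) * t))"
    have Mint: "integrable lborel (\<lambda>t. 2 * K * ((1 + t\<^sup>2) / cosh (pi / real (2 * k) * t)))"
      using k by (intro integrable_mult_right quadratic_over_cosh_integrable) auto
    have pw: "summable (\<lambda>n. (real n + a) powr (c - 3))"
      using c a by (intro summable_shifted_powr) auto
    have "AE t in lborel. summable (\<lambda>n. norm (f n t))"
    proof (rule AE_I2, rule summable_comparison_test')
      fix t
      show "summable (\<lambda>n. (real n + a) powr (c - 3) * (2 * K * ((1 + t\<^sup>2) / cosh (pi / real (2 * k) * t))))"
        by (intro summable_mult2 pw)
    qed (use nf in simp)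
    moreover have "summable (\<lambda>n. LBINT t. norm (f n t))"
    proof (rule summable_comparison_test')
      show "summable (\<lambda>n. (real n + a) powr (c - 3) * ?M)"
        by (intro summable_mult2 pw)
      show "norm (LBINT t. norm (f n t)) \<le> (real n + a) powr (c - 3) * ?M" for n
      proof -
        have "norm (LBINT t. norm (f n t)) = (LBINT t. norm (f n t))" by simp
        also have "\<dots> \<le> (LBINT t. (real n + a) powr (c - 3) * (2 * K * ((1 + t\<^sup>2) / cosh (pi / real (2 * k) * t))))"
          by (intro integral_mono integrable_norm integrable_mult_right fint Mint nf)
        finally show ?thesis by (simp only: integral_mult_right_zero)
      qed
    qed
    ultimately show "(\<lambda>n. LBINT t. f n t) sums (LBINT t. \<Sum>n. f n t)"
      "integrable lborel (\<lambda>t. \<Sum>n. f n t)"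
      using fint by (intro sums_integral integrable_suminf; simp)+
  qed
  have "(\<lambda>n. (-1) ^ n * fdiff (fdiff kernel_term) (real n + a)) sums
          (2 * (2 * S - kernel_term a) - fdiff kernel_term a)"
    by (intro sums_fdiff S)
  hence "(\<lambda>n. 2 * pi * ((-1) ^ n * fdiff (fdiff kernel_term) (real n + a))) sums
          (2 * pi * (2 * (2 * S - kernel_term a) - fdiff kernel_term a))"
    by (rule sums_mult)
  moreover have "(LBINT t. f n t) = 2 * pi * ((-1) ^ n * fdiff (fdiff kernel_term) (real n + a))" for n
    unfolding f_def using a d2(2)[of "real n + a"] by simp
  ultimately have fval: "(LBINT t. \<Sum>n. f n t) = 2 * pi * (2 * (2 * S - kernel_term a) - fdiff kernel_term a)"
    using fsum sums_unique2 by fastforce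
  \<comment> \<open>Two steps suffice on this line, since
    \<open>Re (z t) = 1 - c > -1\<close>.\<close>
  have zeta: "alt_hurwitz_zeta (z t) a * ?W t
      = npow (z t) a * ?W t / 2 + fdiff (npow (z t)) a * ?W t / 4 + (\<Sum>n. f n t) / 4" for t
  proof -
    have "alt_hurwitz_zeta (z t) a = euler_sum 2 a (z t)"
      using a c by (intro alt_hurwitz_zeta_eq_euler_sum) (auto simp: Rez)
    also have "\<dots> = npow (z t) a / 2 + fdiff (npow (z t)) a / 4
        + (\<Sum>n. (-1) ^ n * fdiff (fdiff (npow (z t))) (real n + a)) / 4"
      by (simp add: euler_sum_def numeral_2_eq_2)
    finally have "alt_hurwitz_zeta (z t) a * ?W t = npow (z t) a * ?W t / 2 + fdiff (npow (z t)) a * ?W t / 4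
        + (\<Sum>n. (-1) ^ n * fdiff (fdiff (npow (z t))) (real n + a)) * ?W t / 4"
      by (simp add: algebra_simps)
    also have "(\<Sum>n. (-1) ^ n * fdiff (fdiff (npow (z t))) (real n + a)) * ?W t = (\<Sum>n. f n t)"
    proof -
      have "summable (\<lambda>n. norm ((-1) ^ n * fdiff (fdiff (npow (z t))) (real n + a)))"
        using summable_norm_fdiff_npow[of a 2 "z t"] a c by (simp add: Rez numeral_2_eq_2)
      from suminf_mult2[OF summable_norm_cancel[OF this], of "?W t"] show ?thesis
        by (simp add: f_def mult.assoc)
    qed
    finally show ?thesis .
  qed
  have "alt_hurwitz_kernel c x a k = 1 / (2 * of_real pi * \<i>) * (LBINT t. alt_hurwitz_zeta (z t) a * ?W t * \<i>)"
    by (simp add: alt_hurwitz_kernel_def mellin_barnes_weight_def z_def Let_def)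
  also have "(LBINT t. alt_hurwitz_zeta (z t) a * ?W t * \<i>) = (LBINT t. alt_hurwitz_zeta (z t) a * ?W t) * \<i>"
    by (rule integral_mult_left_zero)
  also have "(LBINT t. alt_hurwitz_zeta (z t) a * ?W t)
      = J a / 2 + 2 * pi * fdiff kernel_term a / 4 + (LBINT t. \<Sum>n. f n t) / 4"
    unfolding zeta J_def using int[OF a] d1[OF a] fsint
    by (simp add: Bochner_Integration.integral_add)
  also have "\<dots> = 2 * pi * (S - C / 2)"
    unfolding fval J[OF a] by (simp add: field_simps)
  also have "1 / (2 * of_real pi * \<i>) * (2 * pi * (S - C / 2) * \<i>) = S - C / 2" by simp
  finally show ?thesis by (simp add: C_def)
qed

end

section \<open>The kernel as a real series\<close>

lemma summable_inverse_shifted_power: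
  assumes "a > 0" "m \<ge> 2"
  shows "summable (\<lambda>n. 1 / (real n + a) ^ m)"
proof -
  have "summable (\<lambda>n. (real n + a) powr (- real m))"
    using assms by (intro summable_shifted_powr) auto
  moreover have "(real n + a) powr (- real m) = 1 / (real n + a) ^ m" for n
    using assms by (simp add: powr_minus powr_realpow inverse_eq_divide)
  ultimately show ?thesis by simp
qed

definition real_kernel :: "real \<Rightarrow> real \<Rightarrow> nat \<Rightarrow> real" where
  "real_kernel x a k = (\<Sum>n. (-1) ^ n * (x ^ (2 * k - 1) / (pi * ((real n + a) ^ (2 * k) + x ^ (2 * k)))))
     - 1 / (2 * pi * x)"

lemma summable_real_kernel:
  assumes "a > 0" "x > 0" "k \<ge> 1"
  shows "summable (\<lambda>n. (-1) ^ n * (x ^ (2 * k - 1) / (pi * ((real n + a) ^ (2 * k) + x ^ (2 * k)))))"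
proof (rule summable_comparison_test')
  show "summable (\<lambda>n. x ^ (2 * k - 1) / pi * (1 / (real n + a) ^ (2 * k)))"
    using assms by (intro summable_mult summable_inverse_shifted_power) auto
  fix n
  have "(real n + a) ^ (2 * k) > 0" using assms by simp
  thus "norm ((-1) ^ n * (x ^ (2 * k - 1) / (pi * ((real n + a) ^ (2 * k) + x ^ (2 * k)))))
      \<le> x ^ (2 * k - 1) / pi * (1 / (real n + a) ^ (2 * k))"
    using assms by (simp add: abs_mult power_abs divide_simps add_pos_pos abs_of_pos)
qed

theorem alt_hurwitz_kernel_eq:
  assumes "1 < c" "c < 2" "a > 0" "x > 0" "k \<ge> 1"
  shows "alt_hurwitz_kernel c x a k = of_real (real_kernel x a k)"
proof -
  let ?g = "\<lambda>n. (-1) ^ n * (x ^ (2 * k - 1) / (pi * ((real n + a) ^ (2 * k) + x ^ (2 * k))))"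
  have "(\<lambda>n. complex_of_real (?g n)) sums of_real (suminf ?g)"
    using summable_real_kernel assms by (intro sums_of_real summable_sums) auto
  hence "(\<lambda>n. (-1) ^ n * kernel_term x k (real n + a)) sums of_real (suminf ?g)"
    using assms by (simp add: kernel_term_def)
  from alt_hurwitz_kernel_eq_alternating_sum[OF assms(1,2,4,5,3) this] show ?thesis
    by (simp add: real_kernel_def)
qed

subsection \<open>Double series\<close>

lemma has_sum_finite_sum:
  fixes f :: "'i \<Rightarrow> 'a \<Rightarrow> 'b :: topological_comm_monoid_add"
  assumes "\<And>i. i \<in> I \<Longrightarrow> (f i has_sum S i) A"
  shows "((\<lambda>x. \<Sum>i\<in>I. f i x) has_sum (\<Sum>i\<in>I. S i)) A"
  using assms by (induction I rule: infinite_finite_induct) (auto intro!: has_sum_add)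

text \<open>Domination by a product of summable sequences makes the family absolutely summable over
  pairs. The unordered sum lets series that were summed in different orders be combined pair by
  pair.\<close>

lemma double_suminf_has_sum:
  fixes f :: "nat \<Rightarrow> nat \<Rightarrow> real"
  assumes "\<And>m n. \<bar>f m n\<bar> \<le> g m * h n" and "summable g" and "summable h"
  shows "((\<lambda>(m, n). f m n) has_sum (\<Sum>m. \<Sum>n. f m n)) UNIV"
    and "summable (\<lambda>m. \<Sum>n. f m n)"
proof -
  have row: "summable (\<lambda>n. norm (f m n))" for m
    by (rule summable_comparison_test'[OF summable_mult[OF assms(3), of "g m"]])
       (use assms(1) in simp)
  have row_sum: "(f m has_sum (\<Sum>n. f m n)) UNIV" for m
    using row[of m] by (intro norm_summable_imp_has_sum summable_sums summable_norm_cancel[OF row])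
  have row_abs: "((\<lambda>n. \<bar>f m n\<bar>) has_sum (\<Sum>n. \<bar>f m n\<bar>)) UNIV" for m
    using row[of m] by (intro norm_summable_imp_has_sum summable_sums) auto
  have le: "norm (\<Sum>n. f m n) \<le> g m * suminf h" "norm (\<Sum>n. \<bar>f m n\<bar>) \<le> g m * suminf h" for m
  proof -
    have "(\<Sum>n. \<bar>f m n\<bar>) \<le> (\<Sum>n. g m * h n)"
      using row[of m] assms by (intro suminf_le summable_mult) auto
    also have "\<dots> = g m * suminf h" using assms by (simp add: suminf_mult)
    finally have *: "(\<Sum>n. \<bar>f m n\<bar>) \<le> g m * suminf h" .
    show "norm (\<Sum>n. f m n) \<le> g m * suminf h"
      using summable_norm[OF row[of m]] * by simp
    show "norm (\<Sum>n. \<bar>f m n\<bar>) \<le> g m * suminf h"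
      using * row[of m] by (simp add: suminf_nonneg)
  qed
  have gs: "summable (\<lambda>m. g m * suminf h)" by (intro summable_mult2 assms)
  have outer: "summable (\<lambda>m. norm (\<Sum>n. f m n))" "summable (\<lambda>m. norm (\<Sum>n. \<bar>f m n\<bar>))"
    by (rule summable_comparison_test'[OF gs], use le in simp)+
  show "summable (\<lambda>m. \<Sum>n. f m n)"
    using outer(1) by (rule summable_norm_cancel)
  have "(\<lambda>(m, n). \<bar>f m n\<bar>) summable_on Sigma UNIV (\<lambda>_. UNIV)"
  proof (rule summable_on_SigmaI)
    show "((\<lambda>n. case (m, n) of (m, n) \<Rightarrow> \<bar>f m n\<bar>) has_sum (\<Sum>n. \<bar>f m n\<bar>)) UNIV" for m
      using row_abs[of m] by simp
    show "(\<lambda>m. \<Sum>n. \<bar>f m n\<bar>) summable_on UNIV"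
      using outer(2) by (intro norm_summable_imp_summable_on)
  qed auto
  hence "(\<lambda>p. norm (case p of (m, n) \<Rightarrow> f m n)) summable_on Sigma UNIV (\<lambda>_. UNIV)"
    by (simp add: case_prod_unfold)
  hence summ: "(\<lambda>(m, n). f m n) summable_on Sigma UNIV (\<lambda>_. UNIV)"
    by (rule abs_summable_summable)
  have "((\<lambda>(m, n). f m n) has_sum (\<Sum>m. \<Sum>n. f m n)) (Sigma UNIV (\<lambda>_. UNIV))"
  proof (rule has_sum_SigmaI[OF _ _ summ])
    show "((\<lambda>n. case (m, n) of (m, n) \<Rightarrow> f m n) has_sum (\<Sum>n. f m n)) UNIV" for m
      using row_sum[of m] by simp
    show "((\<lambda>m. \<Sum>n. f m n) has_sum (\<Sum>m. \<Sum>n. f m n)) UNIV"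
      using outer(1) by (intro norm_summable_imp_has_sum summable_sums summable_norm_cancel[OF outer(1)])
  qed
  thus "((\<lambda>(m, n). f m n) has_sum (\<Sum>m. \<Sum>n. f m n)) UNIV" by simp
qed

lemma double_suminf_swap:
  fixes f :: "nat \<Rightarrow> nat \<Rightarrow> real"
  assumes "\<And>m n. \<bar>f m n\<bar> \<le> g m * h n" and "summable g" and "summable h"
  shows "(\<Sum>n. \<Sum>m. f m n) = (\<Sum>m. \<Sum>n. f m n)"
proof -
  have "((\<lambda>(n, m). f m n) has_sum (\<Sum>n. \<Sum>m. f m n)) UNIV"
    by (rule double_suminf_has_sum(1)[where g = h and h = g]) (use assms in \<open>simp_all add: mult.commute\<close>)
  moreover have "((\<lambda>(n, m). f m n) has_sum (\<Sum>m. \<Sum>n. f m n)) UNIV"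
    using double_suminf_has_sum(1)[OF assms] has_sum_swap[where f = "\<lambda>(m, n). f m n" and A = UNIV and B = UNIV] by simp
  ultimately show ?thesis by (rule has_sum_unique)
qed

text \<open>The case \<open>m = 0\<close> is the value at \<open>0\<close> of the analytic continuation; the series diverges there.\<close>

definition eta_value :: "nat \<Rightarrow> real \<Rightarrow> real" where
  "eta_value m x = (if m = 0 then 1 / 2 else \<Sum>n. (-1) ^ n / (real n + x) ^ m)"

lemma eta_value_sums:
  assumes "x > 0" "m > 0"
  shows "(\<lambda>n. (-1) ^ n / (real n + x) ^ m) sums eta_value m x"
proof -
  have "summable (\<lambda>n. complex_of_real ((-1) ^ n / (real n + x) ^ m))"
    using alt_hurwitz_zeta_of_nat_sums[OF assms] by (auto simp: sums_iff)
  hence "summable (\<lambda>n. (-1) ^ n / (real n + x) ^ m)"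
    using summable_of_real_iff by blast
  thus ?thesis using assms by (simp add: eta_value_def summable_sums)
qed

lemma alt_hurwitz_zeta_of_nat:
  assumes "x > 0"
  shows "alt_hurwitz_zeta (of_nat m) x = of_real (eta_value m x)"
proof (cases "m = 0")
  case True
  thus ?thesis using alt_hurwitz_zeta_0[OF assms] by (simp add: eta_value_def)
next
  case False
  hence "(\<lambda>n. complex_of_real ((-1) ^ n / (real n + x) ^ m)) sums of_real (eta_value m x)"
    using assms by (intro sums_of_real eta_value_sums) auto
  thus ?thesis using alt_hurwitz_zeta_of_nat_sums[OF assms, of m] False sums_unique2 by fastforce
qed

text \<open>Dropping \<open>p * Q\<close> from the second factor of the denominator separates the
  variables, as the product majorants of the double series require.\<close>

lemma rational_kernel_bound:
  fixes p q P Q :: real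
  assumes "p > 0" "q > 0" "P > 0" "Q > 0"
  shows "\<bar>(-1) ^ (m + n) / (Q ^ N * (q * P + p * Q))\<bar> \<le> 1 / Q ^ N * (1 / (q * P))"
proof -
  have "\<bar>(-1) ^ (m + n) / (Q ^ N * (q * P + p * Q))\<bar> = 1 / (Q ^ N * (q * P + p * Q))"
    using assms by (simp add: power_abs abs_mult add_pos_pos abs_of_pos)
  also have "\<dots> \<le> 1 / (Q ^ N * (q * P))"
    using assms by (intro divide_left_mono mult_left_mono mult_pos_pos add_pos_pos) auto
  finally show ?thesis by simp
qed

text \<open>Since \<open>\<alpha> * \<beta> = pi ^ 2\<close>, the square of
  \<open>\<alpha> * B / pi\<close> is \<open>\<alpha> * B ^ 2 / \<beta>\<close>, which brings the
  denominators into a form symmetric under exchange of the two parameters. The summand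
  \<open>- 1 / (2 * pi * x)\<close> of the kernel becomes the separate zeta value.\<close>

lemma kernel_series_sums:
  fixes \<alpha> \<beta> a b :: real and k N :: nat
  assumes \<alpha>: "\<alpha> > 0" and \<beta>: "\<beta> > 0" and \<alpha>\<beta>: "\<alpha> * \<beta> = pi ^ 2"
    and k: "k \<ge> 1" and N: "N \<ge> 1" and a: "a > 0" and b: "b > 0"
  shows "(\<lambda>m. (-1) ^ m * real_kernel (\<alpha> * (real m + b) / pi) a k / (real m + b) ^ (2 * k * (N + 1) - 1))
     sums (\<alpha> ^ k / \<alpha> * (\<Sum>m. \<Sum>n. (-1) ^ (m + n) / (((real m + b) ^ (2 * k)) ^ N *
              (\<beta> ^ k * (real n + a) ^ (2 * k) + \<alpha> ^ k * (real m + b) ^ (2 * k))))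
           - eta_value (2 * k * (N + 1)) b / (2 * \<alpha>))"
proof -
  define f where "f m n = (-1) ^ (m + n) / (((real m + b) ^ (2 * k)) ^ N *
              (\<beta> ^ k * (real n + a) ^ (2 * k) + \<alpha> ^ k * (real m + b) ^ (2 * k)))" for m n
  have term_eq: "(-1) ^ m * real_kernel (\<alpha> * (real m + b) / pi) a k / (real m + b) ^ (2 * k * (N + 1) - 1)
      = \<alpha> ^ k / \<alpha> * (\<Sum>n. f m n) - (-1) ^ m / (real m + b) ^ (2 * k * (N + 1)) * (1 / (2 * \<alpha>))" for m
  proof -
    define B where "B = real m + b"
    define X where "X = \<alpha> * B / pi"
    have B: "B > 0" using b by (simp add: B_def)
    have X: "X > 0" using \<alpha> B by (simp add: X_def)
    have Xk: "X ^ (2 * k) = \<alpha> ^ k * B ^ (2 * k) / \<beta> ^ k"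
    proof -
      have "X ^ 2 = \<alpha> * B ^ 2 / \<beta>"
        unfolding X_def power_divide power_mult_distrib \<alpha>\<beta>[symmetric] using \<alpha> \<beta>
        by (simp add: power2_eq_square field_simps)
      thus ?thesis by (simp add: power_mult power_divide power_mult_distrib)
    qed
    have Xk1: "X ^ (2 * k - 1) = X ^ (2 * k) / X"
      using X k by (simp add: power_diff)
    \<comment> \<open>The power of \<open>B\<close> missing here is restored by the factor
      \<open>1 / X\<close> of \<open>Xk1\<close>.\<close>
    have Bk: "B ^ (2 * k * (N + 1) - 1) = (B ^ (2 * k)) ^ N * B ^ (2 * k) / B"
    proof -
      have "B ^ (2 * k * (N + 1) - 1) = B ^ (2 * k * (N + 1)) / B"
        using B k by (subst power_diff) auto
      thus ?thesis by (simp add: power_mult power_add mult.commute distrib_left flip: power_mult)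
    qed
    have Bk': "B ^ (2 * k * (N + 1)) = (B ^ (2 * k)) ^ N * B ^ (2 * k)"
      by (simp add: power_add distrib_left flip: power_mult)
    have inner: "(-1) ^ m * ((-1) ^ n * (X ^ (2 * k - 1) / (pi * ((real n + a) ^ (2 * k) + X ^ (2 * k)))))
        / B ^ (2 * k * (N + 1) - 1) = \<alpha> ^ k / \<alpha> * f m n" for n
    proof -
      define P where "P = (real n + a) ^ (2 * k)"
      define Q where "Q = B ^ (2 * k)"
      define p q where "p = \<alpha> ^ k" and "q = \<beta> ^ k"
      have pos: "P > 0" "Q > 0" "p > 0" "q > 0" using a B \<alpha> \<beta> by (simp_all add: P_def Q_def p_def q_def)
      hence D: "q * P + p * Q > 0" by (simp add: add_pos_pos)
      have "P + p * Q / q = (q * P + p * Q) / q" using pos by (simp add: field_simps)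
      hence eq: "(p * Q / q / X) / (pi * (P + p * Q / q)) / (Q ^ N * Q / B) = p / \<alpha> * (1 / (Q ^ N * (q * P + p * Q)))"
        using pos D B \<alpha> by (simp add: X_def)
      have "(-1) ^ m * ((-1) ^ n * (u / v)) / w = (-1) ^ (m + n) * (u / v / w)" for u v w :: real
        by (simp add: power_add)
      moreover have "p / \<alpha> * ((-1) ^ (m + n) / w) = (-1) ^ (m + n) * (p / \<alpha> * (1 / w))" for w
        by simp
      ultimately show ?thesis
        unfolding f_def B_def[symmetric] Xk1 Xk Bk P_def[symmetric] Q_def[symmetric] p_def[symmetric] q_def[symmetric]
        by (simp only: eq)
    qed
    let ?g = "\<lambda>n. (-1) ^ n * (X ^ (2 * k - 1) / (pi * ((real n + a) ^ (2 * k) + X ^ (2 * k))))"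
    have "summable ?g" by (rule summable_real_kernel[OF a X k])
    hence "(\<lambda>n. (-1) ^ m * ?g n / B ^ (2 * k * (N + 1) - 1)) sums
             ((-1) ^ m * suminf ?g / B ^ (2 * k * (N + 1) - 1))"
      by (intro sums_divide sums_mult summable_sums)
    hence "(\<lambda>n. \<alpha> ^ k / \<alpha> * f m n) sums ((-1) ^ m * suminf ?g / B ^ (2 * k * (N + 1) - 1))"
      unfolding inner .
    hence S: "\<alpha> ^ k / \<alpha> * (\<Sum>n. f m n) = (-1) ^ m * suminf ?g / B ^ (2 * k * (N + 1) - 1)"
      using \<alpha> by (subst suminf_mult[symmetric]) (auto simp: sums_iff summable_cmult_iff)
    have "(-1) ^ m * real_kernel X a k / B ^ (2 * k * (N + 1) - 1)
        = \<alpha> ^ k / \<alpha> * (\<Sum>n. f m n) - (-1) ^ m * (1 / (2 * pi * X)) / B ^ (2 * k * (N + 1) - 1)"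
      unfolding S by (simp add: real_kernel_def right_diff_distrib diff_divide_distrib)
    also have "(-1) ^ m * (1 / (2 * pi * X)) / B ^ (2 * k * (N + 1) - 1)
        = (-1) ^ m / B ^ (2 * k * (N + 1)) * (1 / (2 * \<alpha>))"
      unfolding Bk Bk' X_def using B \<alpha> by simp
    finally show ?thesis by (simp only: X_def B_def)
  qed
  have "summable (\<lambda>m. \<Sum>n. f m n)"
  proof (rule double_suminf_has_sum(2))
    show "\<bar>f m n\<bar> \<le> 1 / (real m + b) ^ (2 * k * N) * (1 / \<beta> ^ k * (1 / (real n + a) ^ (2 * k)))" for m n
      unfolding f_def using a b \<alpha> \<beta>
      by (rule_tac order_trans[OF rational_kernel_bound]) (simp_all add: power_mult)
    \<comment> \<open>Here \<open>N \<ge> 1\<close> enters: the majorant in \<open>m\<close> comes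
      from the factor with exponent \<open>N\<close> alone.\<close>
    have "k * N \<ge> 1" using k N by simp
    thus "summable (\<lambda>m. 1 / (real m + b) ^ (2 * k * N))"
      using b by (intro summable_inverse_shifted_power) auto
    show "summable (\<lambda>n. 1 / \<beta> ^ k * (1 / (real n + a) ^ (2 * k)))"
      using a k by (intro summable_mult summable_inverse_shifted_power) auto
  qed
  moreover have "(\<lambda>m. (-1) ^ m / (real m + b) ^ (2 * k * (N + 1))) sums eta_value (2 * k * (N + 1)) b"
    using b k by (intro eta_value_sums) auto
  ultimately have "(\<lambda>m. \<alpha> ^ k / \<alpha> * (\<Sum>n. f m n) - (-1) ^ m / (real m + b) ^ (2 * k * (N + 1)) * (1 / (2 * \<alpha>)))
     sums (\<alpha> ^ k / \<alpha> * (\<Sum>m. \<Sum>n. f m n) - eta_value (2 * k * (N + 1)) b * (1 / (2 * \<alpha>)))"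
    by (intro sums_diff sums_mult sums_mult2 summable_sums)
  thus ?thesis unfolding term_eq[symmetric] by (simp add: f_def)
qed

text \<open>Over a common denominator the left side has numerator
  \<open>p * q * ((q * P) ^ N - (- (p * Q)) ^ N)\<close>. The factor \<open>q * P + p * Q\<close> is
  the difference of the two bases and cancels, leaving a geometric sum.\<close>

lemma partial_fraction_identity:
  fixes p q P Q :: real
  assumes "p > 0" "q > 0" "P > 0" "Q > 0"
  shows "p * q ^ (N + 1) * (1 / (Q ^ N * (q * P + p * Q))) - (-1) ^ N * (q * p ^ (N + 1)) * (1 / (P ^ N * (q * P + p * Q)))
     = (\<Sum>j = 1..N. (-1) ^ (j + 1) * p ^ j * q ^ (N + 1 - j) * (1 / P ^ j) * (1 / Q ^ (N + 1 - j)))"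
proof -
  have D: "q * P + p * Q > 0" using assms by (simp add: add_pos_pos)
  have "(q * P) ^ N - (- (p * Q)) ^ N = (q * P + p * Q) * (\<Sum>i<N. (q * P) ^ (N - Suc i) * (- (p * Q)) ^ i)"
  proof -
    have "(q * P) ^ N - (- (p * Q)) ^ N = - ((- (p * Q)) ^ N - (q * P) ^ N)" by simp
    also have "\<dots> = - ((- (p * Q) - q * P) * (\<Sum>i<N. (q * P) ^ (N - Suc i) * (- (p * Q)) ^ i))"
      by (simp only: power_diff_sumr2)
    also have "\<dots> = (q * P + p * Q) * (\<Sum>i<N. (q * P) ^ (N - Suc i) * (- (p * Q)) ^ i)"
    proof -
      have "- ((- (p * Q) - q * P) * z) = (q * P + p * Q) * z" for z
        by (simp add: algebra_simps)
      thus ?thesis .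
    qed
    finally show ?thesis .
  qed
  hence "p * q * ((q * P) ^ N - (- (p * Q)) ^ N) / (P ^ N * Q ^ N * (q * P + p * Q))
     = p * q / (P ^ N * Q ^ N) * (\<Sum>i<N. (q * P) ^ (N - Suc i) * (- (p * Q)) ^ i)"
    using D by simp
  also have "\<dots> = (\<Sum>i<N. p * q / (P ^ N * Q ^ N) * ((q * P) ^ (N - Suc i) * (- (p * Q)) ^ i))"
    by (simp add: sum_distrib_left)
  also have "\<dots> = (\<Sum>j = 1..N. (-1) ^ (j + 1) * p ^ j * q ^ (N + 1 - j) * (1 / P ^ j) * (1 / Q ^ (N + 1 - j)))"
  proof (rule sum.reindex_bij_witness[of _ "\<lambda>j. j - 1" Suc])
    fix i assume i: "i \<in> {..<N}"
    have e: "P ^ N = P ^ (N - Suc i) * P ^ Suc i" "Q ^ N = Q ^ i * Q ^ (N - i)" "q ^ (N - i) = q * q ^ (N - Suc i)"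
      using i by (simp_all add: Suc_diff_Suc flip: power_add power_Suc)
    show "(-1) ^ (Suc i + 1) * p ^ Suc i * q ^ (N + 1 - Suc i) * (1 / P ^ Suc i) * (1 / Q ^ (N + 1 - Suc i))
        = p * q / (P ^ N * Q ^ N) * ((q * P) ^ (N - Suc i) * (- (p * Q)) ^ i)"
      unfolding e using assms by (simp add: e power_mult_distrib power_minus[of "p * Q"]) (simp add: mult_ac)
  qed auto
  finally have *: "p * q * ((q * P) ^ N - (- (p * Q)) ^ N) / (P ^ N * Q ^ N * (q * P + p * Q)) = \<dots>" .
  have "p * q ^ (N + 1) * (1 / (Q ^ N * (q * P + p * Q))) = p * q * (q * P) ^ N / (P ^ N * Q ^ N * (q * P + p * Q))"
    using assms by (simp add: power_mult_distrib)
  moreover have "(-1) ^ N * (q * p ^ (N + 1)) * (1 / (P ^ N * (q * P + p * Q)))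
      = p * q * (- (p * Q)) ^ N / (P ^ N * Q ^ N * (q * P + p * Q))"
    using assms by (simp add: power_mult_distrib power_minus[of "p * Q"])
  ultimately show ?thesis
    unfolding *[symmetric] by (simp add: right_diff_distrib diff_divide_distrib)
qed

text \<open>The partial fraction identity summed over all pairs with sign
  \<open>(-1) ^ (m + n)\<close>. On the right the variables separate, so each double series is a
  product of two alternating series.\<close>

lemma double_series_identity:
  fixes p q a b :: real and k N :: nat
  assumes p: "p > 0" and q: "q > 0" and k: "k \<ge> 1" and N: "N \<ge> 1" and a: "a > 0" and b: "b > 0"
  defines "P \<equiv> \<lambda>n. (real n + a) ^ (2 * k)" and "Q \<equiv> \<lambda>m. (real m + b) ^ (2 * k)"
  shows "p * q ^ (N + 1) * (\<Sum>m. \<Sum>n. (-1) ^ (m + n) / (Q m ^ N * (q * P n + p * Q m)))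
     - (-1) ^ N * (q * p ^ (N + 1)) * (\<Sum>n. \<Sum>m. (-1) ^ (n + m) / (P n ^ N * (p * Q m + q * P n)))
     = (\<Sum>j = 1..N. (-1) ^ (j + 1) * p ^ j * q ^ (N + 1 - j) * eta_value (2 * k * j) a
          * eta_value (2 * k * (N + 1 - j)) b)"
proof -
  have P: "P n > 0" for n using a by (simp add: P_def)
  have Q: "Q m > 0" for m using b by (simp add: Q_def)
  have sP: "summable (\<lambda>n. 1 / P n ^ j)" and sQ: "summable (\<lambda>n. 1 / Q n ^ j)" if "j \<ge> 1" for j
  proof -
    have "k * j \<ge> 1" using k that by simp
    thus "summable (\<lambda>n. 1 / P n ^ j)" "summable (\<lambda>n. 1 / Q n ^ j)"
      using summable_inverse_shifted_power[OF a, of "2 * k * j"] summable_inverse_shifted_power[OF b, of "2 * k * j"]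
      by (simp_all add: P_def Q_def power_mult)
  qed
  define f1 where "f1 m n = (-1) ^ (m + n) / (Q m ^ N * (q * P n + p * Q m))" for m n
  define f2 where "f2 m n = (-1) ^ (n + m) / (P n ^ N * (p * Q m + q * P n))" for m n
  define g where "g j m n = (-1) ^ n * (1 / P n ^ j) * ((-1) ^ m * (1 / Q m ^ (N + 1 - j)))" for j m n
  have h1: "((\<lambda>(m, n). f1 m n) has_sum (\<Sum>m. \<Sum>n. f1 m n)) UNIV"
  proof (rule double_suminf_has_sum)
    show "\<bar>f1 m n\<bar> \<le> 1 / Q m ^ N * (1 / q * (1 / P n ^ 1))" for m n
      using rational_kernel_bound[OF p q P[of n] Q[of m]] by (simp add: f1_def)
  qed (intro sQ N summable_mult sP; simp)+
  \<comment> \<open>The majorant is stated in the index order of \<open>f1\<close>;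
    \<open>double_suminf_swap\<close> then restores the order of summation of the claim.\<close>
  have b2: "\<bar>f2 m n\<bar> \<le> (1 / p * (1 / Q m ^ 1)) * (1 / P n ^ N)" for m n
    using rational_kernel_bound[OF q p Q[of m] P[of n], of n m] by (simp add: f2_def mult.commute)
  have "((\<lambda>(m, n). f2 m n) has_sum (\<Sum>m. \<Sum>n. f2 m n)) UNIV"
    by (rule double_suminf_has_sum[OF b2]) (intro sP N summable_mult sQ; simp)+
  also have "(\<Sum>m. \<Sum>n. f2 m n) = (\<Sum>n. \<Sum>m. f2 m n)"
    by (rule double_suminf_swap[OF b2, symmetric]) (intro sP N summable_mult sQ; simp)+
  finally have h2: "((\<lambda>(m, n). f2 m n) has_sum (\<Sum>n. \<Sum>m. f2 m n)) UNIV" .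
  have hg: "((\<lambda>(m, n). g j m n) has_sum (eta_value (2 * k * j) a * eta_value (2 * k * (N + 1 - j)) b)) UNIV"
    if j: "j \<in> {1..N}" for j
  proof -
    have "((\<lambda>(m, n). g j m n) has_sum (\<Sum>m. \<Sum>n. g j m n)) UNIV"
    proof (rule double_suminf_has_sum)
      show "\<bar>g j m n\<bar> \<le> 1 / Q m ^ (N + 1 - j) * (1 / P n ^ j)" for m n
        using P[of n] Q[of m] by (simp add: g_def abs_mult power_abs mult.commute)
    qed (use j in \<open>auto intro!: sP sQ\<close>)
    also have "(\<Sum>m. \<Sum>n. g j m n) = eta_value (2 * k * j) a * eta_value (2 * k * (N + 1 - j)) b"
    proof -
      have A: "(\<lambda>n. (-1) ^ n * (1 / P n ^ j)) sums eta_value (2 * k * j) a"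
        using eta_value_sums[OF a, of "2 * k * j"] k j by (simp add: P_def power_mult)
      have B: "(\<lambda>m. (-1) ^ m * (1 / Q m ^ (N + 1 - j))) sums eta_value (2 * k * (N + 1 - j)) b"
        using eta_value_sums[OF b, of "2 * k * (N + 1 - j)"] k j by (simp add: Q_def power_mult)
      have "(\<Sum>n. g j m n) = eta_value (2 * k * j) a * ((-1) ^ m * (1 / Q m ^ (N + 1 - j)))" for m
        unfolding g_def by (rule sums_unique[symmetric, OF sums_mult2[OF A]])
      thus ?thesis using sums_unique[OF sums_mult[OF B, of "eta_value (2 * k * j) a"]] by simp
    qed
    finally show ?thesis .
  qed
  have "((\<lambda>x. p * q ^ (N + 1) * (case x of (m, n) \<Rightarrow> f1 m n) + (- ((-1) ^ N * (q * p ^ (N + 1)))) * (case x of (m, n) \<Rightarrow> f2 m n))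
      has_sum (p * q ^ (N + 1) * (\<Sum>m. \<Sum>n. f1 m n) + (- ((-1) ^ N * (q * p ^ (N + 1)))) * (\<Sum>n. \<Sum>m. f2 m n))) UNIV"
    by (intro has_sum_add has_sum_cmult_right h1 h2)
  also have "(\<lambda>x. p * q ^ (N + 1) * (case x of (m, n) \<Rightarrow> f1 m n) + (- ((-1) ^ N * (q * p ^ (N + 1)))) * (case x of (m, n) \<Rightarrow> f2 m n))
     = (\<lambda>x. \<Sum>j = 1..N. (-1) ^ (j + 1) * p ^ j * q ^ (N + 1 - j) * (case x of (m, n) \<Rightarrow> g j m n))"
  proof (rule ext, clarify)
    fix m n
    have "p * q ^ (N + 1) * f1 m n + (- ((-1) ^ N * (q * p ^ (N + 1)))) * f2 m n
       = (-1) ^ (m + n) * (p * q ^ (N + 1) * (1 / (Q m ^ N * (q * P n + p * Q m)))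
            - (-1) ^ N * (q * p ^ (N + 1)) * (1 / (P n ^ N * (q * P n + p * Q m))))"
      by (simp add: f1_def f2_def right_diff_distrib add.commute mult_ac)
    also have "\<dots> = (\<Sum>j = 1..N. (-1) ^ (j + 1) * p ^ j * q ^ (N + 1 - j) * g j m n)"
      unfolding partial_fraction_identity[OF p q P[of n] Q[of m]] sum_distrib_left
      by (intro sum.cong) (simp_all add: g_def power_add)
    finally show "p * q ^ (N + 1) * f1 m n + (- ((-1) ^ N * (q * p ^ (N + 1)))) * f2 m n
      = (\<Sum>j = 1..N. (-1) ^ (j + 1) * p ^ j * q ^ (N + 1 - j) * g j m n)" .
  qed
  finally have "((\<lambda>x. \<Sum>j = 1..N. (-1) ^ (j + 1) * p ^ j * q ^ (N + 1 - j) * (case x of (m, n) \<Rightarrow> g j m n))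
      has_sum (p * q ^ (N + 1) * (\<Sum>m. \<Sum>n. f1 m n) + (- ((-1) ^ N * (q * p ^ (N + 1)))) * (\<Sum>n. \<Sum>m. f2 m n))) UNIV" .
  moreover have "((\<lambda>x. \<Sum>j = 1..N. (-1) ^ (j + 1) * p ^ j * q ^ (N + 1 - j) * (case x of (m, n) \<Rightarrow> g j m n))
      has_sum (\<Sum>j = 1..N. (-1) ^ (j + 1) * p ^ j * q ^ (N + 1 - j) * (eta_value (2 * k * j) a
          * eta_value (2 * k * (N + 1 - j)) b))) UNIV"
    by (intro has_sum_finite_sum has_sum_cmult_right hg) auto
  ultimately have "p * q ^ (N + 1) * (\<Sum>m. \<Sum>n. f1 m n) + (- ((-1) ^ N * (q * p ^ (N + 1)))) * (\<Sum>n. \<Sum>m. f2 m n)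
     = (\<Sum>j = 1..N. (-1) ^ (j + 1) * p ^ j * q ^ (N + 1 - j) * (eta_value (2 * k * j) a
          * eta_value (2 * k * (N + 1 - j)) b))"
    by (rule has_sum_unique)
  thus ?thesis by (simp add: f1_def f2_def mult.assoc)
qed

text \<open>Summability is asserted separately because \<open>suminf\<close> has no specified value
  on a divergent series. The finite sum uses integer powers since the exponents are -1 at its two
  ends.\<close>

theorem theorem1p21:
  fixes \<alpha> \<beta> a b c :: real and k N :: nat
  assumes "\<alpha> > 0" and "\<beta> > 0" and "\<alpha> * \<beta> = pi ^ 2"
    and "k \<ge> 1" and "N \<ge> 1"
    and "a > 0" and "b > 0"
    and "1 < c" and "c < 2"
  shows
    "summable (\<lambda>n. (-1) ^ n * scaled_alt_hurwitz_kernel c \<alpha> (real n + b) a k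
        / of_real (real n + b) ^ (2 * k * (N + 1) - 1)) \<and>
     summable (\<lambda>n. (-1) ^ n * scaled_alt_hurwitz_kernel c \<beta> (real n + a) b k
        / of_real (real n + a) ^ (2 * k * (N + 1) - 1)) \<and>
     of_real (\<beta> ^ (k * (N + 1) - 1)) *
       (\<Sum>n. (-1) ^ n * scaled_alt_hurwitz_kernel c \<alpha> (real n + b) a k
          / of_real (real n + b) ^ (2 * k * (N + 1) - 1)) =
     (-1) ^ N * of_real (\<alpha> ^ (k * (N + 1) - 1)) *
       (\<Sum>n. (-1) ^ n * scaled_alt_hurwitz_kernel c \<beta> (real n + a) b k
          / of_real (real n + a) ^ (2 * k * (N + 1) - 1))
     + (\<Sum>p = 0..N + 1. (-1) ^ (p + 1)
          * alt_hurwitz_zeta (of_nat (2 * k * p)) a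
          * alt_hurwitz_zeta (of_nat (2 * k * (N + 1 - p))) b
          * of_real (\<alpha> powi (int (k * p) - 1) * \<beta> powi (int (k * (N + 1 - p)) - 1)))"
proof -
  note [simp] = assms(1,2)
  define M where "M = k * (N + 1)"
  have M: "M \<ge> 1" using assms(4) by (simp add: M_def)
  let ?S = "\<Sum>m. \<Sum>n. (-1) ^ (m + n) / (((real m + b) ^ (2 * k)) ^ N *
              (\<beta> ^ k * (real n + a) ^ (2 * k) + \<alpha> ^ k * (real m + b) ^ (2 * k)))"
  let ?T = "\<Sum>n. \<Sum>m. (-1) ^ (n + m) / (((real n + a) ^ (2 * k)) ^ N *
              (\<alpha> ^ k * (real m + b) ^ (2 * k) + \<beta> ^ k * (real n + a) ^ (2 * k)))"
  define A where "A = \<alpha> ^ k / \<alpha> * ?S - eta_value (2 * M) b / (2 * \<alpha>)"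
  define B where "B = \<beta> ^ k / \<beta> * ?T - eta_value (2 * M) a / (2 * \<beta>)"
  have eqs: "2 * k * (N + 1) = 2 * M" by (simp add: M_def)
  have term1: "(-1) ^ n * scaled_alt_hurwitz_kernel c \<gamma> (real n + y) x k / of_real (real n + y) ^ (2 * k * (N + 1) - 1)
      = of_real ((-1) ^ n * real_kernel (\<gamma> * (real n + y) / pi) x k / (real n + y) ^ (2 * k * (N + 1) - 1))"
    if "\<gamma> > 0" "x > 0" "y > 0" for \<gamma> x y n
    unfolding scaled_alt_hurwitz_kernel_def using that assms by (subst alt_hurwitz_kernel_eq) auto
  have A: "(\<lambda>n. (-1) ^ n * scaled_alt_hurwitz_kernel c \<alpha> (real n + b) a k
        / of_real (real n + b) ^ (2 * k * (N + 1) - 1)) sums of_real A"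
    unfolding term1[OF assms(1,6,7)] A_def
    using kernel_series_sums[OF assms(1-7)] by (intro sums_of_real) (simp only: eqs)
  have B: "(\<lambda>n. (-1) ^ n * scaled_alt_hurwitz_kernel c \<beta> (real n + a) b k
        / of_real (real n + a) ^ (2 * k * (N + 1) - 1)) sums of_real B"
    unfolding term1[OF assms(2,7,6)] B_def
    \<comment> \<open>The same lemma with \<alpha> and \<beta>, and \<open>a\<close> and
      \<open>b\<close>, exchanged.\<close>
    using kernel_series_sums[OF assms(2,1) _ assms(4,5,7,6)] assms(3)
    by (intro sums_of_real) (simp only: eqs mult.commute[of \<beta> \<alpha>])
  define E where "E p = (-1) ^ (p + 1) * eta_value (2 * k * p) a * eta_value (2 * k * (N + 1 - p)) b
       * (\<alpha> powi (int (k * p) - 1) * \<beta> powi (int (k * (N + 1 - p)) - 1))" for p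
  have powi: "\<gamma> powi (int n - 1) = \<gamma> ^ n / \<gamma>" if "\<gamma> > 0" for \<gamma> :: real and n
    using that by (simp add: power_int_diff)
  have E: "E p = 1 / (\<alpha> * \<beta>) * ((-1) ^ (p + 1) * (\<alpha> ^ k) ^ p * (\<beta> ^ k) ^ (N + 1 - p)
       * eta_value (2 * k * p) a * eta_value (2 * k * (N + 1 - p)) b)" for p
    unfolding E_def powi[OF assms(1)] powi[OF assms(2)] by (simp add: power_mult)
  have pw: "(\<gamma> ^ k) ^ (N + 1) = \<gamma> ^ M" for \<gamma> :: real
    by (simp only: M_def power_mult)
  have eta_0: "eta_value 0 y = 1 / 2" for y
    by (simp add: eta_value_def)
  \<comment> \<open>At both ends one zeta value is taken at 0 and equals 1/2. These terms match the
    zeta values split off in \<open>A\<close> and \<open>B\<close>; the inner ones match the double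
    series.\<close>
  have "(\<Sum>p = 0..N + 1. E p) = E 0 + (\<Sum>p = 1..N. E p) + E (N + 1)"
    using assms(5) by (simp add: sum.atLeast_Suc_atMost)
  also have "(\<Sum>p = 1..N. E p) = 1 / (\<alpha> * \<beta>) * (\<alpha> ^ k * (\<beta> ^ k) ^ (N + 1) * ?S
     - (-1) ^ N * (\<beta> ^ k * (\<alpha> ^ k) ^ (N + 1)) * ?T)"
    using double_series_identity[of "\<alpha> ^ k" "\<beta> ^ k" k N a b] assms
    by (simp only: E sum_distrib_left[symmetric]) simp
  also have "E 0 = - (eta_value (2 * M) b / (2 * \<alpha>) * (\<beta> ^ M / \<beta>))"
    using E[of 0] by (simp only: diff_zero pw eqs mult_0_right power_0 eta_0) (simp add: mult_ac)
  also have "E (N + 1) = (-1) ^ N * (eta_value (2 * M) a / (2 * \<beta>) * (\<alpha> ^ M / \<alpha>))"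
    using E[of "N + 1"] by (simp only: diff_self_eq_0 pw eqs mult_0_right power_0 eta_0) (simp add: mult_ac)
  also have "- (eta_value (2 * M) b / (2 * \<alpha>) * (\<beta> ^ M / \<beta>)) + 1 / (\<alpha> * \<beta>) * (\<alpha> ^ k * (\<beta> ^ k) ^ (N + 1) * ?S
        - (-1) ^ N * (\<beta> ^ k * (\<alpha> ^ k) ^ (N + 1)) * ?T)
        + (-1) ^ N * (eta_value (2 * M) a / (2 * \<beta>) * (\<alpha> ^ M / \<alpha>))
      = \<beta> ^ M / \<beta> * A - (-1) ^ N * (\<alpha> ^ M / \<alpha>) * B"
  proof -
    have gen: "- (u / (2 * \<alpha>) * (r / \<beta>)) + 1 / (\<alpha> * \<beta>) * (p * r * S - s * (q * r') * T)
        + s * (v / (2 * \<beta>) * (r' / \<alpha>))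
      = r / \<beta> * (p / \<alpha> * S - u / (2 * \<alpha>)) - s * (r' / \<alpha>) * (q / \<beta> * T - v / (2 * \<beta>))"
      for u v r r' p q S T s :: real
      by (simp add: diff_divide_distrib add_divide_distrib algebra_simps)
    show ?thesis unfolding A_def B_def pw by (rule gen)
  qed
  finally have sumE: "(\<Sum>p = 0..N + 1. E p) = \<beta> ^ M / \<beta> * A - (-1) ^ N * (\<alpha> ^ M / \<alpha>) * B" .
  \<comment> \<open>The natural subtraction does not truncate, because
    \<open>M \<ge> 1\<close>.\<close>
  have M1: "\<gamma> ^ (k * (N + 1) - 1) = \<gamma> ^ M / \<gamma>" if "\<gamma> > 0" for \<gamma> :: real
    unfolding M_def[symmetric] using that M by (simp add: power_diff)
  have main: "of_real (\<beta> ^ (k * (N + 1) - 1)) * of_real A = 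
      (-1) ^ N * of_real (\<alpha> ^ (k * (N + 1) - 1)) * of_real B + complex_of_real (\<Sum>p = 0..N + 1. E p)"
    unfolding sumE M1[OF assms(1)] M1[OF assms(2)] by simp
  have "complex_of_real (\<Sum>p = 0..N + 1. E p) = (\<Sum>p = 0..N + 1. (-1) ^ (p + 1)
          * alt_hurwitz_zeta (of_nat (2 * k * p)) a
          * alt_hurwitz_zeta (of_nat (2 * k * (N + 1 - p))) b
          * of_real (\<alpha> powi (int (k * p) - 1) * \<beta> powi (int (k * (N + 1 - p)) - 1)))"
    unfolding alt_hurwitz_zeta_of_nat[OF assms(6)] alt_hurwitz_zeta_of_nat[OF assms(7)] E_def of_real_sum
    by (intro sum.cong refl) (simp only: of_real_mult of_real_power of_real_minus of_real_1)
  thus ?thesis using A B main by (auto simp only: sums_iff)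
qed

end
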